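(* Let $\kappa\ge 2$ be a fixed integer. There is a polynomial time algorithm for BM' if and only if there is a polynomial time algorithm for $\kappa$-BM'.
   Context: The $2$-covariate $\kappa$-BM problem has the following input: - a finite set $\mathcal{T}$ of treatment samples and a finite set $\mathcal{C}$ of control samples; - two covariates; covariate $p$ ($p=1,2$) has $k_p$ levels and partitions $\mathcal{T}$ into $L_{p,1},\dots,L_{p,k_p}$ with sizes $\ell_{p,i}$, and $\mathcal{C}$ into $L'_{p,1},\dots,L'_{p,k_p}$; - distances $\delta_{tc}$. The task is to assign each $t\in\mathcal{T}$ a set $A_t\subseteq\mathcal{C}$ of exactly $\kappa$ control samples, subject to two conditions: - the sets $A_t$ are pairwise disjoint; - $S'=\bigcup_tA_t$ satisfies $|S'\cap L'_{p,i}|=\kappa\ell_{p,i}$ for all $p$ and $i$. The objective is to minimize $\sum_t\sum_{c\in A_t}\delta_{tc}$, or to report infeasibility. The BM problem is the case $\kappa=1$. BM' (respectively $\kappa$-BM') is the special case of the $2$-covariate BM (respectively $\kappa$-BM) problem in which: - the second covariate has a constant number of levels; - the distances are nonnegative integers bounded by a polynomial $\pi$ of the input encoding length. *)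

theory Defs
  imports "HOL-Computational_Algebra.Polynomial"
begin

text \<open>
  Model of computation: Jones' WHILE language, whose data are binary trees and whose stores assign
  a tree to each of finitely many used variables. Evaluating an expression is charged the number
  of nodes of every tree produced on the way (not one unit per operation), so that repeatedly
  pairing a tree with itself is paid for. Hence a Turing machine simulates a run of cost \<open>t\<close> with
  polynomial overhead in \<open>t\<close> and the input size, and a WHILE program simulates a Turing machine
  step (on a tape stored as two lists) by a bounded number of commands whose cost is linear in the
  length of the tape: polynomial time here is the usual polynomial time.
\<close>

datatype data = Leaf | Node data data

fun dsize :: "data \<Rightarrow> nat" where
  "dsize Leaf = 1"
| "dsize (Node a b) = Suc (dsize a + dsize b)"

fun dhd :: "data \<Rightarrow> data" where
  "dhd Leaf = Leaf"
| "dhd (Node a b) = a"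

fun dtl :: "data \<Rightarrow> data" where
  "dtl Leaf = Leaf"
| "dtl (Node a b) = b"

type_synonym store = "nat \<Rightarrow> data"

datatype expr = Var nat | Nl | Cns expr expr | Hd expr | Tl expr | Eq expr expr

fun eval :: "store \<Rightarrow> expr \<Rightarrow> data" where
  "eval s (Var x) = s x"
| "eval s Nl = Leaf"
| "eval s (Cns e f) = Node (eval s e) (eval s f)"
| "eval s (Hd e) = dhd (eval s e)"
| "eval s (Tl e) = dtl (eval s e)"
| "eval s (Eq e f) = (if eval s e = eval s f then Node Leaf Leaf else Leaf)"

fun ecost :: "store \<Rightarrow> expr \<Rightarrow> nat" where
  "ecost s (Var x) = dsize (s x)"
| "ecost s Nl = 1"
| "ecost s (Cns e f) = ecost s e + ecost s f + dsize (eval s (Cns e f))"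
| "ecost s (Hd e) = ecost s e + dsize (eval s (Hd e))"
| "ecost s (Tl e) = ecost s e + dsize (eval s (Tl e))"
| "ecost s (Eq e f) = ecost s e + ecost s f + dsize (eval s (Eq e f))"

datatype com =
    Assign nat expr
  | Seq com com
  | Cond expr com com
  | While expr com

text \<open>\<open>exec c s t s'\<close>: started in store \<open>s\<close>, program \<open>c\<close> halts in store \<open>s'\<close> at cost \<open>t\<close>.
  A test succeeds iff its value is not \<open>Leaf\<close>.\<close>

inductive exec :: "com \<Rightarrow> store \<Rightarrow> nat \<Rightarrow> store \<Rightarrow> bool" where
  Assign: "exec (Assign x e) s (ecost s e) (s(x := eval s e))"
| Seq: "exec c s t s' \<Longrightarrow> exec d s' t' s'' \<Longrightarrow> exec (Seq c d) s (t + t') s''"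
| CondT: "eval s e \<noteq> Leaf \<Longrightarrow> exec c s t s' \<Longrightarrow> exec (Cond e c d) s (ecost s e + t) s'"
| CondF: "eval s e = Leaf \<Longrightarrow> exec d s t s' \<Longrightarrow> exec (Cond e c d) s (ecost s e + t) s'"
| WhileF: "eval s e = Leaf \<Longrightarrow> exec (While e c) s (ecost s e) s"
| WhileT: "eval s e \<noteq> Leaf \<Longrightarrow> exec c s t s' \<Longrightarrow> exec (While e c) s' t' s'' \<Longrightarrow>
    exec (While e c) s (ecost s e + t + t') s''"

inductive_cases exec_AssignE: "exec (Assign x e) s t s'"
inductive_cases exec_SeqE: "exec (Seq c d) s t s'"
inductive_cases exec_CondE: "exec (Cond e c d) s t s'"
inductive_cases exec_WhileE: "exec (While e c) s t s'"

lemma exec_deterministic: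
  "exec c s t s' \<Longrightarrow> exec c s u s'' \<Longrightarrow> u = t \<and> s'' = s'"
proof (induction arbitrary: u s'' rule: exec.induct)
  case (Assign x e s)
  then show ?case by (auto elim: exec_AssignE)
next
  case (Seq c s t s' d t' s'')
  from Seq.prems show ?case by (rule exec_SeqE) (use Seq.IH in blast)
next
  case (CondT s e c t s' d)
  from CondT.prems show ?case by (rule exec_CondE) (use CondT in blast)+
next
  case (CondF s e d t s' c)
  from CondF.prems show ?case by (rule exec_CondE) (use CondF in blast)+
next
  case (WhileF s e c)
  from WhileF.prems show ?case by (rule exec_WhileE) (use WhileF in blast)+
next
  case (WhileT s e c t s' t' s'')
  from WhileT.prems show ?case by (rule exec_WhileE) (use WhileT in blast)+
qed

text \<open>Input and output are held in variable 0; all other variables are initially empty.\<close>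

definition init_store :: "data \<Rightarrow> store" where
  "init_store d = (\<lambda>_. Leaf)(0 := d)"

text \<open>
  A problem consists of its instances, their encoding, and the relation telling which output data
  are correct for an instance. Nothing is required on inputs that do not encode an instance.
  Natural number coefficients suffice, as every real polynomial is dominated by such a polynomial.
\<close>

definition poly_time_solvable ::
  "'i set \<Rightarrow> ('i \<Rightarrow> data) \<Rightarrow> ('i \<Rightarrow> data \<Rightarrow> bool) \<Rightarrow> bool" where
  "poly_time_solvable Inst enc correct \<longleftrightarrow>
     (\<exists>(c :: com) (q :: nat poly). \<forall>I\<in>Inst. \<exists>t s.
        exec c (init_store (enc I)) t s \<and>
        t \<le> poly q (dsize (enc I)) \<and>
        correct I (s 0))"

text \<open>
  Instances: the treatment samples are \<open>0, \<dots>, n - 1\<close> and the control samples \<open>0, \<dots>, m - 1\<close>.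
  The \<open>t\<close>-th entry of \<open>treat\<close> is the pair of the levels of treatment sample \<open>t\<close> under the
  two covariates, similarly for \<open>ctrl\<close>; the levels of covariate \<open>p\<close> are numbered from 0, and
  a level may contain no treatment or no control sample.
  Distances are left polymorphic; the problems with nonnegative integer
  distances are those with \<open>'d = nat\<close>.
\<close>

record 'd bm =
  levels1 :: nat
  levels2 :: nat
  treat :: "(nat \<times> nat) list"
  ctrl :: "(nat \<times> nat) list"
  dist :: "'d list list"

definition well_formed :: "'d bm \<Rightarrow> bool" where
  "well_formed I \<longleftrightarrow>
     (\<forall>(i, j) \<in> set (treat I) \<union> set (ctrl I). i < levels1 I \<and> j < levels2 I) \<and>
     length (dist I) = length (treat I) \<and>
     (\<forall>row \<in> set (dist I). length row = length (ctrl I))"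

definition num_treat :: "'d bm \<Rightarrow> nat" where
  "num_treat I = length (treat I)"

definition num_ctrl :: "'d bm \<Rightarrow> nat" where
  "num_ctrl I = length (ctrl I)"

definition delta :: "'d bm \<Rightarrow> nat \<Rightarrow> nat \<Rightarrow> 'd" where
  "delta I t c = dist I ! t ! c"

definition num_levels :: "'d bm \<Rightarrow> nat \<Rightarrow> nat" where
  "num_levels I p = (if p = 1 then levels1 I else levels2 I)"

definition cov :: "nat \<Rightarrow> nat \<times> nat \<Rightarrow> nat" where
  "cov p x = (if p = 1 then fst x else snd x)"

text \<open>The parts \<open>L\<^sub>p\<^sub>,\<^sub>i\<close> and \<open>L'\<^sub>p\<^sub>,\<^sub>i\<close>.\<close>

definition treat_part :: "'d bm \<Rightarrow> nat \<Rightarrow> nat \<Rightarrow> nat set" where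
  "treat_part I p i = {t. t < num_treat I \<and> cov p (treat I ! t) = i}"

definition ctrl_part :: "'d bm \<Rightarrow> nat \<Rightarrow> nat \<Rightarrow> nat set" where
  "ctrl_part I p i = {c. c < num_ctrl I \<and> cov p (ctrl I ! c) = i}"

definition feasible :: "nat \<Rightarrow> 'd bm \<Rightarrow> (nat \<Rightarrow> nat set) \<Rightarrow> bool" where
  "feasible \<kappa> I A \<longleftrightarrow>
     (\<forall>t < num_treat I. A t \<subseteq> {..<num_ctrl I} \<and> card (A t) = \<kappa>) \<and>
     (\<forall>t < num_treat I. \<forall>u < num_treat I. t \<noteq> u \<longrightarrow> A t \<inter> A u = {}) \<and>
     (\<forall>p \<in> {1, 2}. \<forall>i < num_levels I p.
        card ((\<Union>t<num_treat I. A t) \<inter> ctrl_part I p i) = \<kappa> * card (treat_part I p i))"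

definition cost :: "'d::comm_monoid_add bm \<Rightarrow> (nat \<Rightarrow> nat set) \<Rightarrow> 'd" where
  "cost I A = (\<Sum>t<num_treat I. \<Sum>c\<in>A t. delta I t c)"

definition optimal :: "nat \<Rightarrow> 'd::{comm_monoid_add, linorder} bm \<Rightarrow> (nat \<Rightarrow> nat set) \<Rightarrow> bool" where
  "optimal \<kappa> I A \<longleftrightarrow> feasible \<kappa> I A \<and> (\<forall>B. feasible \<kappa> I B \<longrightarrow> cost I A \<le> cost I B)"

text \<open>An answer is \<open>None\<close> (infeasible) or a list whose \<open>t\<close>-th entry enumerates \<open>A\<^sub>t\<close>.\<close>

type_synonym answer = "nat list list option"

definition solution ::
  "nat \<Rightarrow> 'd::{comm_monoid_add, linorder} bm \<Rightarrow> answer \<Rightarrow> bool" where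
  "solution \<kappa> I ans \<longleftrightarrow> (case ans of
       None \<Rightarrow> \<not> (\<exists>A. feasible \<kappa> I A)
     | Some xss \<Rightarrow> length xss = num_treat I \<and> (\<forall>xs \<in> set xss. distinct xs) \<and>
         optimal \<kappa> I (\<lambda>t. set (xss ! t)))"

text \<open>
  Encodings. Distances are written in binary (least significant bit first). Numbers of levels,
  level indices and sample indices are written in unary: an input listing all parts and all samples
  is at least as long as these numbers, so this affects its length only polynomially.
\<close>

fun enc_unary :: "nat \<Rightarrow> data" where
  "enc_unary 0 = Leaf"
| "enc_unary (Suc n) = Node Leaf (enc_unary n)"

fun enc_binary :: "nat \<Rightarrow> data" where
  "enc_binary n = (if n = 0 then Leaf
     else Node (if odd n then Node Leaf Leaf else Leaf) (enc_binary (n div 2)))"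

declare enc_binary.simps [simp del]

definition enc_list :: "('a \<Rightarrow> data) \<Rightarrow> 'a list \<Rightarrow> data" where
  "enc_list f xs = foldr (\<lambda>x d. Node (f x) d) xs Leaf"

definition enc_pair :: "nat \<times> nat \<Rightarrow> data" where
  "enc_pair x = Node (enc_unary (fst x)) (enc_unary (snd x))"

definition enc_bm :: "nat bm \<Rightarrow> data" where
  "enc_bm I =
     Node (enc_unary (levels1 I))
    (Node (enc_unary (levels2 I))
    (Node (enc_list enc_pair (treat I))
    (Node (enc_list enc_pair (ctrl I))
          (enc_list (enc_list enc_binary) (dist I)))))"

definition enc_answer :: "answer \<Rightarrow> data" where
  "enc_answer ans = (case ans of
       None \<Rightarrow> Leaf
     | Some xss \<Rightarrow> Node (enc_list (enc_list enc_unary) xss) Leaf)"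

lemma enc_list_inj: "inj f \<Longrightarrow> inj (enc_list f)"
proof (rule injI)
  fix xs ys assume "inj f" "enc_list f xs = enc_list f ys"
  then show "xs = ys"
  proof (induction xs arbitrary: ys)
    case Nil
    then show ?case by (cases ys) (auto simp: enc_list_def)
  next
    case (Cons x xs)
    then show ?case by (cases ys) (auto simp: enc_list_def dest: injD)
  qed
qed

lemma enc_unary_inj: "inj enc_unary"
proof (rule injI)
  fix m n assume "enc_unary m = enc_unary n"
  then show "m = n"
  proof (induction m arbitrary: n)
    case 0
    then show ?case by (cases n) auto
  next
    case (Suc m)
    then show ?case by (cases n) auto
  qed
qed

lemma enc_binary_inj: "inj enc_binary"
proof (rule injI)
  fix m n assume "enc_binary m = enc_binary n"
  then show "m = n"
  proof (induction m arbitrary: n rule: less_induct)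
    case (less m)
    show ?case
    proof (cases "m = 0 \<or> n = 0")
      case True
      with less.prems show ?thesis
        by (subst (asm) (1 2) enc_binary.simps) (auto split: if_splits)
    next
      case False
      with less.prems have "enc_binary (m div 2) = enc_binary (n div 2)" "odd m = odd n"
        by (subst (asm) (1 2) enc_binary.simps; auto split: if_splits)+
      with less.IH[of "m div 2" "n div 2"] False show ?thesis
        by (auto elim!: evenE oddE)
    qed
  qed
qed

lemma enc_bm_inj: "inj enc_bm"
proof (rule injI)
  fix I J :: "nat bm" assume *: "enc_bm I = enc_bm J"
  have "inj enc_pair"
    by (rule injI) (auto simp: enc_pair_def prod_eq_iff dest: injD[OF enc_unary_inj])
  with * show "I = J"
    by (auto simp: enc_bm_def dest: injD[OF enc_unary_inj] injD[OF enc_list_inj]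
        injD[OF enc_list_inj[OF enc_list_inj[OF enc_binary_inj]]] intro!: bm.equality)
qed

lemma enc_answer_inj: "inj enc_answer"
  by (rule injI)
     (auto simp: enc_answer_def split: option.splits
       dest: injD[OF enc_list_inj[OF enc_list_inj[OF enc_unary_inj]]])

text \<open>The instances of BM' and \<open>\<kappa>\<close>-BM' for a fixed number \<open>K\<close> of levels of the second covariate
  and a fixed polynomial \<open>\<pi>\<close> bounding the distances in terms of the encoding length.\<close>

definition BM'_instances :: "nat \<Rightarrow> nat poly \<Rightarrow> nat bm set" where
  "BM'_instances K \<pi> = {I. well_formed I \<and> num_levels I 2 = K \<and>
     (\<forall>t < num_treat I. \<forall>c < num_ctrl I. delta I t c \<le> poly \<pi> (dsize (enc_bm I)))}"

definition kappa_BM'_poly_time :: "nat \<Rightarrow> nat \<Rightarrow> nat poly \<Rightarrow> bool" where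
  "kappa_BM'_poly_time \<kappa> K \<pi> \<longleftrightarrow>
     poly_time_solvable (BM'_instances K \<pi>) enc_bm
       (\<lambda>I d. \<exists>ans. d = enc_answer ans \<and> solution \<kappa> I ans)"

definition BM'_poly_time :: "nat \<Rightarrow> nat poly \<Rightarrow> bool" where
  "BM'_poly_time K \<pi> \<longleftrightarrow> kappa_BM'_poly_time 1 K \<pi>"

end

theory Submission
  imports Defs
begin

text \<open>
  From \<open>\<kappa>\<close>-BM' to BM': replace every treatment sample by \<open>\<kappa>\<close> copies and let a treatment sample
  receive the control samples of all its copies.

  From BM' to \<open>\<kappa>\<close>-BM': give every treatment sample \<open>\<kappa> - 1\<close> dummy control samples with its own
  levels, at distance 0 from it and at distance \<open>w\<close> from all others, and add \<open>w\<close> to all original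
  distances. Only \<open>\<kappa> - 1\<close> controls are free for each of the \<open>n\<close> treatment samples, so every
  assignment costs at least \<open>n * w\<close>; if \<open>w\<close> exceeds the cost of every solution of the BM' instance
  and this instance is feasible, then an optimal assignment costs less than \<open>(n + 1) * w\<close>, hence
  consists of all own dummies and one original control per treatment sample. A power of two serves
  as \<open>w\<close>: adding it to a smaller number in binary is padding the digits with zeros and a final one,
  and a power of suitable size is polynomially bounded.

  The reductions are composed from functions on binary trees that are closed under pairing, case
  distinction and folding over lists with polynomially bounded intermediate results.
\<close>

section \<open>Polynomial time functions on binary trees\<close>

text \<open>The bound on the distances cannot be kept fixed: dummies raise distances by
  \<open>w\<close>, so BM' for \<pi> is reduced to \<kappa>-BM' for a larger polynomial. This is why
  each side of the equivalence quantifies over all polynomials. The number of levels is preserved,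
  as dummies introduce no new level.

  The size of \<open>w\<close> enters at one point: an optimal assignment without exactly one real
  control per sample proves the BM' instance infeasible. When the counts are right, the surcharge
  \<open>n * w\<close> cancels in every comparison. So postprocessing counts controls and never
  computes a cost.

  On the machine side, the algorithm given by hypothesis is an arbitrary program that expects empty
  registers, whereas the functions built by closure can be placed at any base register. A frame
  property joins the two. Closure under folding is not free: a step that pairs its accumulator with
  itself runs in polynomial time, but iterating it gives exponential size. Each fold therefore needs
  a bound on its accumulator, in most cases an additive growth per step that is independent of the
  accumulator.\<close>

definition runs :: "com \<Rightarrow> store \<Rightarrow> nat \<Rightarrow> (store \<Rightarrow> bool) \<Rightarrow> bool" where
  "runs c s T P \<longleftrightarrow> (\<exists>t s'. exec c s t s' \<and> t \<le> T \<and> P s')"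

lemma runs_mono: "runs c s T P \<Longrightarrow> T \<le> U \<Longrightarrow> (\<And>s'. P s' \<Longrightarrow> Q s') \<Longrightarrow> runs c s U Q"
  unfolding runs_def by (meson order_trans)

lemma runs_Assign: "P (s(x := eval s e)) \<Longrightarrow> ecost s e \<le> T \<Longrightarrow> runs (Assign x e) s T P"
  unfolding runs_def using exec.Assign by blast

lemma runs_Seq:
  assumes "runs c s T P" "\<And>s'. P s' \<Longrightarrow> runs d s' U Q"
  shows "runs (Seq c d) s (T + U) Q"
proof -
  from assms(1) obtain t s' where 1: "exec c s t s'" "t \<le> T" "P s'"
    by (auto simp: runs_def)
  from assms(2)[OF 1(3)] obtain u s'' where 2: "exec d s' u s''" "u \<le> U" "Q s''"
    by (auto simp: runs_def)
  from exec.Seq[OF 1(1) 2(1)] 1 2 show ?thesis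
    unfolding runs_def by (meson add_mono)
qed

lemma runs_Assign_Seq:
  "runs d (s(x := eval s e)) U Q \<Longrightarrow> runs (Seq (Assign x e) d) s (ecost s e + U) Q"
  by (rule runs_Seq[where P = "\<lambda>s'. s' = s(x := eval s e)"]) (auto intro: runs_Assign)

lemma runs_Cond:
  assumes "eval s e \<noteq> Leaf \<Longrightarrow> runs c s T P" "eval s e = Leaf \<Longrightarrow> runs d s T P"
  shows "runs (Cond e c d) s (ecost s e + T) P"
proof (cases "eval s e = Leaf")
  case True
  from assms(2)[OF this] obtain t s' where "exec d s t s'" "t \<le> T" "P s'"
    by (auto simp: runs_def)
  with exec.CondF[OF True this(1)] show ?thesis
    unfolding runs_def by (meson add_left_mono)
next
  case False
  from assms(1)[OF this] obtain t s' where "exec c s t s'" "t \<le> T" "P s'"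
    by (auto simp: runs_def)
  with exec.CondT[OF False this(1)] show ?thesis
    unfolding runs_def by (meson add_left_mono)
qed

lemma runs_WhileF: "eval s e = Leaf \<Longrightarrow> P s \<Longrightarrow> ecost s e \<le> T \<Longrightarrow> runs (While e c) s T P"
  unfolding runs_def using exec.WhileF by blast

lemma runs_WhileT:
  assumes "eval s e \<noteq> Leaf" "runs c s T P" "\<And>s'. P s' \<Longrightarrow> runs (While e c) s' U Q"
  shows "runs (While e c) s (ecost s e + T + U) Q"
proof -
  from assms(2) obtain t s' where 1: "exec c s t s'" "t \<le> T" "P s'"
    by (auto simp: runs_def)
  from assms(3)[OF 1(3)] obtain u s'' where 2: "exec (While e c) s' u s''" "u \<le> U" "Q s''"
    by (auto simp: runs_def)
  from exec.WhileT[OF assms(1) 1(1) 2(1)] 1 2 show ?thesis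
    unfolding runs_def by (meson add_mono order_refl)
qed

lemma dsize_pos: "0 < dsize d"
  by (cases d) auto

lemma dsize_ge_1: "1 \<le> dsize d"
  by (simp add: dsize_pos Suc_leI)

lemma dsize_dhd_dtl_le: "dsize (dhd d) \<le> dsize d" "dsize (dtl d) \<le> dsize d"
  by (cases d; simp)+

lemma dsize_eval_le_ecost: "dsize (eval s e) \<le> ecost s e"
  by (induction e) (simp_all add: dsize_ge_1)

text \<open>An expression pays for all nodes of its value, so a register cannot outgrow the cost.
  This turns time bounds into bounds on output sizes.\<close>

lemma exec_dsize_le: "exec c s t s' \<Longrightarrow> dsize (s' x) \<le> dsize (s x) + t"
proof (induction rule: exec.induct)
  case (Assign y e s)
  then show ?case using dsize_eval_le_ecost[of s e] by (simp add: trans_le_add2)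
qed auto

lemma poly_nat_mono: "a \<le> b \<Longrightarrow> poly q a \<le> poly q (b::nat)"
  by (induction q) (auto intro: add_mono mult_mono)

section \<open>Polynomial bounds and closure of polynomial time functions\<close>

definition poly_bounded :: "(data \<Rightarrow> nat) \<Rightarrow> bool" where
  "poly_bounded F \<longleftrightarrow> (\<exists>q :: nat poly. \<forall>d. F d \<le> poly q (dsize d))"

lemma poly_bounded_dsize: "poly_bounded dsize"
  unfolding poly_bounded_def by (rule exI[of _ "[:0, 1:]"]) simp

lemma poly_bounded_const: "poly_bounded (\<lambda>_. k)"
  unfolding poly_bounded_def by (rule exI[of _ "[:k:]"]) simp

lemma poly_bounded_add:
  assumes "poly_bounded F" "poly_bounded G"
  shows "poly_bounded (\<lambda>d. F d + G d)"
proof -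
  from assms obtain p q where "\<forall>d. F d \<le> poly p (dsize d)" "\<forall>d. G d \<le> poly q (dsize d)"
    by (auto simp: poly_bounded_def)
  then show ?thesis unfolding poly_bounded_def
    by (intro exI[of _ "p + q"]) (auto intro: add_mono)
qed

lemma poly_bounded_mult:
  assumes "poly_bounded F" "poly_bounded G"
  shows "poly_bounded (\<lambda>d. F d * G d)"
proof -
  from assms obtain p q where "\<forall>d. F d \<le> poly p (dsize d)" "\<forall>d. G d \<le> poly q (dsize d)"
    by (auto simp: poly_bounded_def)
  then show ?thesis unfolding poly_bounded_def
    by (intro exI[of _ "p * q"]) (auto intro: mult_mono)
qed

lemma poly_bounded_poly:
  assumes "poly_bounded F"
  shows "poly_bounded (\<lambda>d. poly p (F d))"
proof -
  from assms obtain q where "\<forall>d. F d \<le> poly q (dsize d)"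
    by (auto simp: poly_bounded_def)
  then show ?thesis unfolding poly_bounded_def
    by (intro exI[of _ "pcompose p q"]) (auto simp: poly_pcompose intro: poly_nat_mono)
qed

lemma poly_bounded_mono: "poly_bounded G \<Longrightarrow> (\<And>d. F d \<le> G d) \<Longrightarrow> poly_bounded F"
  unfolding poly_bounded_def using order_trans by blast

lemmas poly_bounded_intros =
  poly_bounded_dsize poly_bounded_const poly_bounded_add poly_bounded_mult poly_bounded_poly

text \<open>The program may be placed at any base register \<open>b\<close>: it reads and overwrites \<open>b\<close>, leaves the
  registers below alone, and presupposes nothing about those above. This is what makes the notion
  closed under composition.\<close>

definition ptime :: "(data \<Rightarrow> data) \<Rightarrow> bool" where
  "ptime f \<longleftrightarrow> (\<exists>T. poly_bounded T \<and>
     (\<forall>b. \<exists>c. \<forall>s. runs c s (T (s b)) (\<lambda>s'. s' b = f (s b) \<and> (\<forall>x<b. s' x = s x))))"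

lemma ptimeI:
  assumes "poly_bounded T"
    and "\<And>b s. runs (c b) s (T (s b)) (\<lambda>s'. s' b = f (s b) \<and> (\<forall>x<b. s' x = s x))"
  shows "ptime f"
  unfolding ptime_def
  by (rule exI[of _ T], intro conjI allI exI[of _ "c b" for b], rule assms(1), rule assms(2))

lemma ptimeE:
  assumes "ptime f"
  obtains T c where "poly_bounded T"
    "\<And>b s. runs (c b) s (T (s b)) (\<lambda>s'. s' b = f (s b) \<and> (\<forall>x<b. s' x = s x))"
proof -
  from assms obtain T where T: "poly_bounded T" and
    "\<forall>b. \<exists>c. \<forall>s. runs c s (T (s b)) (\<lambda>s'. s' b = f (s b) \<and> (\<forall>x<b. s' x = s x))"
    unfolding ptime_def by (elim exE conjE)
  from choice[OF this(2)] obtain c where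
    "\<forall>b s. runs (c b) s (T (s b)) (\<lambda>s'. s' b = f (s b) \<and> (\<forall>x<b. s' x = s x))"
    by (elim exE)
  then show ?thesis
    by (intro that[OF T, of c]) simp
qed

lemma ptime_poly_bounded:
  assumes "ptime f"
  shows "poly_bounded (\<lambda>d. dsize (f d))"
proof -
  from assms obtain T c where T: "poly_bounded T"
    and c: "\<And>b s. runs (c b) s (T (s b)) (\<lambda>s'. s' b = f (s b) \<and> (\<forall>x<b. s' x = s x))"
    by (rule ptimeE) blast
  have "dsize (f d) \<le> dsize d + T d" for d
    using c[of 0 "\<lambda>_. d"] unfolding runs_def
    by (metis add_left_mono exec_dsize_le order_trans)
  then show ?thesis
    by (rule poly_bounded_mono[rotated]) (intro poly_bounded_intros T)
qed

lemma ptime_poly_boundedE: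
  assumes "ptime f"
  obtains q :: "nat poly" where "\<And>d. dsize (f d) \<le> poly q (dsize d)"
  using ptime_poly_bounded[OF assms] unfolding poly_bounded_def by blast

lemma ptime_id: "ptime (\<lambda>d. d)"
  by (rule ptimeI[where T = dsize and c = "\<lambda>b. Assign b (Var b)"])
     (auto intro: runs_Assign poly_bounded_intros)

lemma ptime_Leaf: "ptime (\<lambda>d. Leaf)"
  by (rule ptimeI[where T = "\<lambda>_. 1" and c = "\<lambda>b. Assign b Nl"])
     (auto intro: runs_Assign poly_bounded_intros)

lemma ptime_comp:
  assumes "ptime f" "ptime g"
  shows "ptime (\<lambda>d. g (f d))"
proof -
  from assms(1) obtain T c where T: "poly_bounded T"
    and c: "\<And>b s. runs (c b) s (T (s b)) (\<lambda>s'. s' b = f (s b) \<and> (\<forall>x<b. s' x = s x))"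
    by (rule ptimeE) blast
  from assms(2) obtain U e where U: "poly_bounded U"
    and e: "\<And>b s. runs (e b) s (U (s b)) (\<lambda>s'. s' b = g (s b) \<and> (\<forall>x<b. s' x = s x))"
    by (rule ptimeE) blast
  from U obtain q where q: "\<And>d. U d \<le> poly q (dsize d)"
    by (auto simp: poly_bounded_def)
  show ?thesis
  proof (rule ptimeI)
    show "poly_bounded (\<lambda>d. T d + poly q (dsize (f d)))"
      by (intro poly_bounded_intros T ptime_poly_bounded assms)
    show "runs (Seq (c b) (e b)) s (T (s b) + poly q (dsize (f (s b))))
        (\<lambda>s'. s' b = g (f (s b)) \<and> (\<forall>x<b. s' x = s x))" for b s
      by (rule runs_Seq[OF c]) (rule runs_mono[OF e], use q in auto)
  qed
qed

lemma ptime_dhd: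
  assumes "ptime f"
  shows "ptime (\<lambda>d. dhd (f d))"
proof (rule ptime_comp[OF assms])
  show "ptime dhd"
  proof (rule ptimeI)
    show "poly_bounded (\<lambda>d. dsize d + dsize d)"
      by (intro poly_bounded_intros)
    show "runs (Assign b (Hd (Var b))) s (dsize (s b) + dsize (s b))
      (\<lambda>s'. s' b = dhd (s b) \<and> (\<forall>x<b. s' x = s x))" for b s
      by (rule runs_Assign) (auto simp: dsize_dhd_dtl_le)
  qed
qed

lemma ptime_dtl:
  assumes "ptime f"
  shows "ptime (\<lambda>d. dtl (f d))"
proof (rule ptime_comp[OF assms])
  show "ptime dtl"
  proof (rule ptimeI)
    show "poly_bounded (\<lambda>d. dsize d + dsize d)"
      by (intro poly_bounded_intros)
    show "runs (Assign b (Tl (Var b))) s (dsize (s b) + dsize (s b))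
      (\<lambda>s'. s' b = dtl (s b) \<and> (\<forall>x<b. s' x = s x))" for b s
      by (rule runs_Assign) (auto simp: dsize_dhd_dtl_le)
  qed
qed

lemma runs_call:
  assumes "\<And>b s. runs (c b) s (T (s b)) (\<lambda>s'. s' b = f (s b) \<and> (\<forall>x<b. s' x = s x))"
  shows "runs (Seq (Assign y e) (c y)) s (ecost s e + T (eval s e))
    (\<lambda>s'. s' y = f (eval s e) \<and> (\<forall>x<y. s' x = s x))"
  by (rule runs_Assign_Seq) (rule runs_mono[OF assms], auto)

text \<open>A program may destroy everything above its base, so intermediate results are stacked
  upwards: the value of \<open>g\<close> waits in register \<open>b + 1\<close> while
  \<open>f\<close> is computed at \<open>b + 2\<close>.\<close>

lemma ptime_Node:
  assumes "ptime f" "ptime g"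
  shows "ptime (\<lambda>d. Node (f d) (g d))"
proof -
  from assms(1) obtain T c where T: "poly_bounded T"
    and c: "\<And>b s. runs (c b) s (T (s b)) (\<lambda>s'. s' b = f (s b) \<and> (\<forall>x<b. s' x = s x))"
    by (rule ptimeE) blast
  from assms(2) obtain U e where U: "poly_bounded U"
    and e: "\<And>b s. runs (e b) s (U (s b)) (\<lambda>s'. s' b = g (s b) \<and> (\<forall>x<b. s' x = s x))"
    by (rule ptimeE) blast
  show ?thesis
  proof (rule ptimeI)
    show "poly_bounded (\<lambda>d. (dsize d + U d) + ((dsize d + T d) +
        (dsize (f d) + dsize (g d) + (1 + (dsize (f d) + dsize (g d))))))"
      by (intro poly_bounded_intros T U ptime_poly_bounded assms)
    show "runs (Seq (Seq (Assign (Suc b) (Var b)) (e (Suc b)))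
        (Seq (Seq (Assign (b + 2) (Var b)) (c (b + 2))) (Assign b (Cns (Var (b + 2)) (Var (Suc b))))))
        s ((dsize (s b) + U (s b)) + ((dsize (s b) + T (s b)) +
        (dsize (f (s b)) + dsize (g (s b)) + (1 + (dsize (f (s b)) + dsize (g (s b)))))))
        (\<lambda>s'. s' b = Node (f (s b)) (g (s b)) \<and> (\<forall>x<b. s' x = s x))" for b s
      by (rule runs_Seq[OF runs_mono[OF runs_call[OF e]]], simp, assumption,
          rule runs_Seq[OF runs_mono[OF runs_call[OF c]]], simp, assumption,
          rule runs_Assign) auto
  qed
qed

lemma ptime_if_Leaf:
  assumes "ptime f" "ptime g" "ptime h"
  shows "ptime (\<lambda>d. if f d = Leaf then g d else h d)"
proof -
  from assms(1) obtain T c where T: "poly_bounded T"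
    and c: "\<And>b s. runs (c b) s (T (s b)) (\<lambda>s'. s' b = f (s b) \<and> (\<forall>x<b. s' x = s x))"
    by (rule ptimeE) blast
  from assms(2) obtain U e where U: "poly_bounded U"
    and e: "\<And>b s. runs (e b) s (U (s b)) (\<lambda>s'. s' b = g (s b) \<and> (\<forall>x<b. s' x = s x))"
    by (rule ptimeE) blast
  from assms(3) obtain V k where V: "poly_bounded V"
    and k: "\<And>b s. runs (k b) s (V (s b)) (\<lambda>s'. s' b = h (s b) \<and> (\<forall>x<b. s' x = s x))"
    by (rule ptimeE) blast
  show ?thesis
  proof (rule ptimeI)
    show "poly_bounded (\<lambda>d. (dsize d + T d) + (dsize (f d) + (V d + U d)))"
      by (intro poly_bounded_intros T U V ptime_poly_bounded assms)
    show "runs (Seq (Seq (Assign (Suc b) (Var b)) (c (Suc b))) (Cond (Var (Suc b)) (k b) (e b)))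
        s ((dsize (s b) + T (s b)) + (dsize (f (s b)) + (V (s b) + U (s b))))
        (\<lambda>s'. s' b = (if f (s b) = Leaf then g (s b) else h (s b)) \<and> (\<forall>x<b. s' x = s x))" for b s
    proof (rule runs_Seq[OF runs_mono[OF runs_call[OF c]]], simp, assumption)
      fix s1 assume "s1 (Suc b) = f (eval s (Var b)) \<and> (\<forall>x<Suc b. s1 x = s x)"
      then have *: "s1 (Suc b) = f (s b)" "s1 b = s b" "\<And>x. x < b \<Longrightarrow> s1 x = s x"
        by auto
      have "runs (Cond (Var (Suc b)) (k b) (e b)) s1
        (ecost s1 (Var (Suc b)) + (V (s b) + U (s b)))
        (\<lambda>s'. s' b = (if f (s b) = Leaf then g (s b) else h (s b)) \<and> (\<forall>x<b. s' x = s x))"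
        by (rule runs_Cond) (rule runs_mono[OF k] runs_mono[OF e]; use * in auto)+
      then show "runs (Cond (Var (Suc b)) (k b) (e b)) s1
        (dsize (f (s b)) + (V (s b) + U (s b)))
        (\<lambda>s'. s' b = (if f (s b) = Leaf then g (s b) else h (s b)) \<and> (\<forall>x<b. s' x = s x))"
        by (simp add: *)
    qed
  qed
qed

lemma ptime_Eq: "ptime (\<lambda>d. if dhd d = dtl d then Node Leaf Leaf else Leaf)"
proof (rule ptimeI)
  show "poly_bounded (\<lambda>d. (dsize d + dsize d) + (dsize d + dsize d) + 3)"
    by (intro poly_bounded_intros)
  show "runs (Assign b (Eq (Hd (Var b)) (Tl (Var b)))) s
    ((dsize (s b) + dsize (s b)) + (dsize (s b) + dsize (s b)) + 3)
    (\<lambda>s'. s' b = (if dhd (s b) = dtl (s b) then Node Leaf Leaf else Leaf) \<and> (\<forall>x<b. s' x = s x))"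
    for b s
    by (rule runs_Assign, simp, simp only: ecost.simps eval.simps, intro add_mono)
       (auto simp: dsize_dhd_dtl_le)
qed

lemma ptime_if_eq:
  assumes "ptime f" "ptime g" "ptime h" "ptime k"
  shows "ptime (\<lambda>d. if f d = g d then h d else k d)"
proof -
  have "ptime (\<lambda>d. if dhd (Node (f d) (g d)) = dtl (Node (f d) (g d)) then Node Leaf Leaf else Leaf)"
    by (rule ptime_comp[OF _ ptime_Eq]) (rule ptime_Node assms)+
  then have "ptime (\<lambda>d. if (if f d = g d then Node Leaf Leaf else Leaf) = Leaf then k d else h d)"
    by (intro ptime_if_Leaf assms) simp
  moreover have "(\<lambda>d. if (if f d = g d then Node Leaf Leaf else Leaf) = Leaf then k d else h d) =
      (\<lambda>d. if f d = g d then h d else k d)"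
    by auto
  ultimately show ?thesis
    by simp
qed

section \<open>Folds over lists, where every tree counts as a list\<close>

fun dfoldl :: "(data \<Rightarrow> data \<Rightarrow> data) \<Rightarrow> data \<Rightarrow> data \<Rightarrow> data" where
  "dfoldl H a Leaf = a"
| "dfoldl H a (Node x L) = dfoldl H (H x a) L"

fun dfoldr :: "(data \<Rightarrow> data \<Rightarrow> data) \<Rightarrow> data \<Rightarrow> data \<Rightarrow> data" where
  "dfoldr H a Leaf = a"
| "dfoldr H a (Node x L) = H x (dfoldr H a L)"

text \<open>Extends the processed prefix in the loop invariant by the entry just consumed.\<close>

fun dsnoc :: "data \<Rightarrow> data \<Rightarrow> data" where
  "dsnoc Leaf x = Node x Leaf"
| "dsnoc (Node y L) x = Node y (dsnoc L x)"

lemma dfoldl_dsnoc: "dfoldl H a (dsnoc L x) = H x (dfoldl H a L)"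
  by (induction L arbitrary: a) auto

lemma dsize_dsnoc: "dsize (dsnoc L x) = Suc (dsize L + dsize x)"
  by (induction L) auto

text \<open>The registers of the loop: \<open>b\<close> holds the parameter \<open>d\<close>, \<open>b + 1\<close> the rest of the list,
  \<open>b + 2\<close> the accumulator and \<open>b + 3\<close> the argument of the step.\<close>

definition fold_body :: "nat \<Rightarrow> (nat \<Rightarrow> com) \<Rightarrow> com" where
  "fold_body b c = Seq
     (Seq (Assign (b + 3) (Cns (Var b) (Cns (Hd (Var (b + 1))) (Var (b + 2))))) (c (b + 3)))
     (Seq (Assign (b + 2) (Var (b + 3))) (Assign (b + 1) (Tl (Var (b + 1)))))"

text \<open>\<open>L\<^sub>0\<close> is the part already consumed and \<open>L\<close> the rest.
  Both sizes count a final \<open>Leaf\<close>, so their sum may exceed the size \<open>S\<close> of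
  the whole list by one. \<open>B\<close> bounds the accumulator after every prefix, so each round
  costs at most the same amount.\<close>

lemma runs_fold_loop:
  assumes step: "\<And>b s. runs (c b) s (V (s b))
      (\<lambda>s'. s' b = H (dhd (s b)) (dhd (dtl (s b))) (dtl (dtl (s b))) \<and> (\<forall>x<b. s' x = s x))"
    and V: "\<And>z. V z \<le> poly q (dsize z)"
    and acc: "\<And>L. dsize L \<le> S \<Longrightarrow> dsize (dfoldl (H d) a L) \<le> B"
  shows "dsize L + dsize L\<^sub>0 \<le> Suc S \<Longrightarrow> s b = d \<Longrightarrow> s (b + 1) = L \<Longrightarrow>
    s (b + 2) = dfoldl (H d) a L\<^sub>0 \<Longrightarrow>
    runs (While (Var (b + 1)) (fold_body b c)) s
      (dsize L * (9 * (dsize d + S + B + 2) + poly q (dsize d + S + B + 2)))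
      (\<lambda>s'. s' (b + 2) = dfoldl (H d) (dfoldl (H d) a L\<^sub>0) L \<and> (\<forall>x\<le>b. s' x = s x))"
proof (induction L arbitrary: s L\<^sub>0)
  case Leaf
  then show ?case
    by (intro runs_WhileF) (auto simp: dsize_ge_1)
next
  case (Node x L)
  \<comment> \<open>\<open>?Z\<close> bounds the argument \<open>?z\<close> of the step function;
    the 2 counts its two pairing nodes. Of the nine copies of \<open>?Z\<close> charged per entry,
    eight cover the assignments of the body and one the loop test.\<close>
  let ?Z = "dsize d + S + B + 2"
  let ?C = "9 * ?Z + poly q ?Z"
  let ?a = "dfoldl (H d) a L\<^sub>0"
  let ?z = "Node d (Node x ?a)"
  have "1 \<le> dsize L\<^sub>0"
    by (rule dsize_ge_1)
  with Node.prems(1) have S: "dsize x + dsize L + 1 \<le> S" "dsize (dsnoc L\<^sub>0 x) \<le> S"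
    using dsize_ge_1[of L] by (auto simp: dsize_dsnoc)
  have "dsize L\<^sub>0 \<le> S"
    using S(2) by (simp add: dsize_dsnoc)
  note B = acc[OF this] acc[OF S(2), unfolded dfoldl_dsnoc]
  let ?P = "\<lambda>s'. s' b = d \<and> s' (b + 1) = L \<and> s' (b + 2) = dfoldl (H d) a (dsnoc L\<^sub>0 x) \<and>
    (\<forall>y\<le>b. s' y = s y)"
  have q: "V ?z \<le> poly q ?Z"
    by (rule order_trans[OF V]) (intro poly_nat_mono, use S B in auto)
  have "runs (fold_body b c) s
      ((ecost s (Cns (Var b) (Cns (Hd (Var (b + 1))) (Var (b + 2)))) + V ?z) +
       (dsize (H d x ?a) + (dsize (Node x L) + dsize L))) ?P"
    unfolding fold_body_def
    apply (rule runs_Seq[OF runs_mono[OF runs_call[OF step]]])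
      apply (use Node.prems in simp)
     apply assumption
    apply (rule runs_mono[OF runs_Assign_Seq[OF runs_Assign[where P = ?P]]])
       apply (use Node.prems in \<open>auto simp: dfoldl_dsnoc\<close>)
    done
  then have body: "runs (fold_body b c) s (8 * ?Z + poly q ?Z) ?P"
    by (rule runs_mono) (use q S B Node.prems in auto)
  have "runs (While (Var (b + 1)) (fold_body b c)) s
      (ecost s (Var (b + 1)) + (8 * ?Z + poly q ?Z) + dsize L * ?C)
      (\<lambda>s'. s' (b + 2) = dfoldl (H d) (dfoldl (H d) a (dsnoc L\<^sub>0 x)) L \<and> (\<forall>x\<le>b. s' x = s x))"
    apply (rule runs_WhileT[OF _ body])
     apply (use Node.prems in simp)
    apply (rule runs_mono[OF Node.IH(2)[where L\<^sub>0 = "dsnoc L\<^sub>0 x"]])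
         apply (use Node.prems in \<open>auto simp: dsize_dsnoc\<close>)
    done
  then show ?case
  proof (rule runs_mono)
    have "ecost s (Var (b + 1)) \<le> ?Z"
      using S Node.prems by simp
    then have "ecost s (Var (b + 1)) + (8 * ?Z + poly q ?Z) + dsize L * ?C \<le> (1 + dsize L) * ?C"
      by (simp add: algebra_simps)
    also have "\<dots> \<le> dsize (Node x L) * ?C"
      by (intro mult_right_mono) auto
    finally show "ecost s (Var (b + 1)) + (8 * ?Z + poly q ?Z) + dsize L * ?C
      \<le> dsize (Node x L) * ?C" .
  qed (simp add: dfoldl_dsnoc)
qed

text \<open>The hypothesis \<open>acc\<close> excludes exponential growth, which a polynomial time
  step alone permits. It is required for all lists, so it applies to every prefix of
  \<open>f d\<close>.\<close>

lemma ptime_dfoldl: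
  assumes "ptime f" "ptime g"
    and "ptime (\<lambda>z. H (dhd z) (dhd (dtl z)) (dtl (dtl z)))"
    and acc: "\<And>d L. dsize (dfoldl (H d) (g d) L) \<le> poly p (dsize d + dsize L)"
  shows "ptime (\<lambda>d. dfoldl (H d) (g d) (f d))"
proof -
  from assms(1) obtain T c where T: "poly_bounded T"
    and c: "\<And>b s. runs (c b) s (T (s b)) (\<lambda>s'. s' b = f (s b) \<and> (\<forall>x<b. s' x = s x))"
    by (rule ptimeE) blast
  from assms(2) obtain U e where U: "poly_bounded U"
    and e: "\<And>b s. runs (e b) s (U (s b)) (\<lambda>s'. s' b = g (s b) \<and> (\<forall>x<b. s' x = s x))"
    by (rule ptimeE) blast
  from assms(3) obtain V k where V: "poly_bounded V"
    and k: "\<And>b s. runs (k b) s (V (s b))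
      (\<lambda>s'. s' b = H (dhd (s b)) (dhd (dtl (s b))) (dtl (dtl (s b))) \<and> (\<forall>x<b. s' x = s x))"
    by (rule ptimeE) blast
  from V obtain q where q: "\<And>d. V d \<le> poly q (dsize d)"
    by (auto simp: poly_bounded_def)
  define B where "B = (\<lambda>d. poly p (dsize d + dsize (f d)))"
  define W where "W = (\<lambda>d. dsize (f d) * (9 * (dsize d + dsize (f d) + B d + 2) +
    poly q (dsize d + dsize (f d) + B d + 2)))"
  show ?thesis
  proof (rule ptimeI)
    show "poly_bounded (\<lambda>d. (dsize d + T d) + ((dsize d + U d) + (W d + B d)))"
      unfolding W_def B_def
      by (intro poly_bounded_intros T U ptime_poly_bounded assms)
    fix b :: nat and s :: store
    have acc': "dsize (dfoldl (H (s b)) (g (s b)) L) \<le> B (s b)" if "dsize L \<le> dsize (f (s b))" for L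
      unfolding B_def by (rule order_trans[OF acc]) (intro poly_nat_mono, use that in auto)
    show "runs (Seq (Seq (Assign (b + 1) (Var b)) (c (b + 1)))
      (Seq (Seq (Assign (b + 2) (Var b)) (e (b + 2)))
      (Seq (While (Var (b + 1)) (fold_body b k)) (Assign b (Var (b + 2))))))
      s ((dsize (s b) + T (s b)) + ((dsize (s b) + U (s b)) + (W (s b) + B (s b))))
      (\<lambda>s'. s' b = dfoldl (H (s b)) (g (s b)) (f (s b)) \<and> (\<forall>x<b. s' x = s x))"
    proof (rule runs_Seq[OF runs_mono[OF runs_call[OF c]]], simp, assumption)
      fix s1
      assume s1: "s1 (b + 1) = f (eval s (Var b)) \<and> (\<forall>x<b + 1. s1 x = s x)"
      show "runs (Seq (Seq (Assign (b + 2) (Var b)) (e (b + 2)))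
        (Seq (While (Var (b + 1)) (fold_body b k)) (Assign b (Var (b + 2)))))
        s1 ((dsize (s b) + U (s b)) + (W (s b) + B (s b)))
        (\<lambda>s'. s' b = dfoldl (H (s b)) (g (s b)) (f (s b)) \<and> (\<forall>x<b. s' x = s x))"
      proof (rule runs_Seq[OF runs_mono[OF runs_call[OF e]]])
        show "ecost s1 (Var b) + U (eval s1 (Var b)) \<le> dsize (s b) + U (s b)"
          using s1 by simp
        fix s2
        assume "s2 (b + 2) = g (eval s1 (Var b)) \<and> (\<forall>x<b + 2. s2 x = s1 x)"
        with s1 have s2: "s2 (b + 1) = f (s b)" "s2 (b + 2) = g (s b)" "\<And>x. x \<le> b \<Longrightarrow> s2 x = s x"
          by auto
        have "runs (While (Var (b + 1)) (fold_body b k)) s2 (W (s b))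
          (\<lambda>s'. s' (b + 2) = dfoldl (H (s b)) (g (s b)) (f (s b)) \<and> (\<forall>x\<le>b. s' x = s x))"
          by (rule runs_mono[OF runs_fold_loop[where L = "f (s b)" and L\<^sub>0 = Leaf and d = "s b"
                  and a = "g (s b)" and S = "dsize (f (s b))" and B = "B (s b)" and V = V, OF k q acc']])
             (assumption | use s2 in \<open>simp add: W_def\<close>)+
        then show "runs (Seq (While (Var (b + 1)) (fold_body b k)) (Assign b (Var (b + 2))))
          s2 (W (s b) + B (s b))
          (\<lambda>s'. s' b = dfoldl (H (s b)) (g (s b)) (f (s b)) \<and> (\<forall>x<b. s' x = s x))"
          by (rule runs_Seq) (auto intro!: runs_Assign acc')
      qed assumption
    qed
  qed
qed

fun drev :: "data \<Rightarrow> data" where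
  "drev Leaf = Leaf"
| "drev (Node x L) = dsnoc (drev L) x"

lemma dfoldr_dsnoc: "dfoldr H a (dsnoc L x) = dfoldr H (H x a) L"
  by (induction L) auto

lemma dfoldr_drev: "dfoldr H a (drev L) = dfoldl H a L"
  by (induction L arbitrary: a) (auto simp: dfoldr_dsnoc)

lemma dfoldl_drev: "dfoldl H a (drev L) = dfoldr H a L"
  by (induction L arbitrary: a) (auto simp: dfoldl_dsnoc)

lemma dsize_drev: "dsize (drev L) = dsize L"
  by (induction L) (auto simp: dsize_dsnoc)

lemma dfoldr_Node: "dfoldr Node Leaf L = L"
  by (induction L) auto

lemma dfoldl_Node: "dfoldl Node Leaf L = drev L"
  by (simp add: dfoldr_drev[symmetric] dfoldr_Node)

lemmas ptime_basic_intros = ptime_id ptime_Leaf ptime_Node ptime_dhd ptime_dtl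

lemma ptime_drev:
  assumes "ptime f"
  shows "ptime (\<lambda>d. drev (f d))"
proof -
  have "ptime (\<lambda>d. dfoldl Node Leaf (f d))"
  proof (rule ptime_dfoldl[OF assms, where H = "\<lambda>_. Node"])
    show "dsize (dfoldl Node Leaf L) \<le> poly [:0, 1:] (dsize d + dsize L)" for d L
      by (simp add: dfoldl_Node dsize_drev)
  qed (intro ptime_basic_intros)+
  then show ?thesis
    by (simp add: dfoldl_Node)
qed

text \<open>A loop consumes a list from its head, so a right fold is a left fold over the reversed
  list.\<close>

lemma ptime_dfoldr:
  assumes "ptime f" "ptime g"
    and "ptime (\<lambda>z. H (dhd z) (dhd (dtl z)) (dtl (dtl z)))"
    and "\<And>d L. dsize (dfoldr (H d) (g d) L) \<le> poly p (dsize d + dsize L)"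
  shows "ptime (\<lambda>d. dfoldr (H d) (g d) (f d))"
proof -
  have "ptime (\<lambda>d. dfoldl (H d) (g d) (drev (f d)))"
    by (rule ptime_dfoldl[where p = p])
       (use assms(4)[of _ "drev L" for L] in \<open>auto intro: ptime_drev assms simp: dfoldr_drev dsize_drev\<close>)
  then show ?thesis
    by (simp add: dfoldl_drev)
qed

lemma dsize_dfoldr_le:
  assumes "\<And>x a. dsize (H x a) \<le> dsize a + poly p (k + dsize x)"
  shows "dsize (dfoldr H a L) \<le> dsize a + dsize L * poly p (k + dsize L)"
proof (induction L)
  case (Node x L)
  have "dsize (dfoldr H a (Node x L)) \<le> dsize a + dsize L * poly p (k + dsize L) + poly p (k + dsize x)"
    using assms[of x "dfoldr H a L"] Node by simp
  also have "\<dots> \<le> dsize a + dsize L * poly p (k + dsize (Node x L)) + poly p (k + dsize (Node x L))"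
    by (intro add_mono mult_mono poly_nat_mono) auto
  also have "\<dots> \<le> dsize a + dsize (Node x L) * poly p (k + dsize (Node x L))"
    by (simp add: algebra_simps)
  finally show ?case .
qed simp

text \<open>The usual way to discharge the bound on the accumulator: if each step adds an amount
  depending only on the parameter and the entry, the total is at most the number of steps times one
  such amount.\<close>

lemma ptime_dfoldr_growth:
  assumes "ptime f" "ptime g"
    and "ptime (\<lambda>z. H (dhd z) (dhd (dtl z)) (dtl (dtl z)))"
    and "\<And>d x a. dsize (H d x a) \<le> dsize a + poly p (dsize d + dsize x)"
  shows "ptime (\<lambda>d. dfoldr (H d) (g d) (f d))"
proof -
  from ptime_poly_boundedE[OF assms(2)] obtain q where q: "\<And>d. dsize (g d) \<le> poly q (dsize d)"
    by blast
  show ?thesis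
  proof (rule ptime_dfoldr[OF assms(1-3)])
    fix d L
    have "dsize (dfoldr (H d) (g d) L) \<le> dsize (g d) + dsize L * poly p (dsize d + dsize L)"
      by (rule dsize_dfoldr_le) (rule assms(4))
    also have "\<dots> \<le> poly q (dsize d + dsize L) + (dsize d + dsize L) * poly p (dsize d + dsize L)"
      by (intro add_mono mult_right_mono order_trans[OF q] poly_nat_mono) auto
    also have "\<dots> = poly (q + [:0, 1:] * p) (dsize d + dsize L)"
      by simp
    finally show "dsize (dfoldr (H d) (g d) L) \<le> poly (q + [:0, 1:] * p) (dsize d + dsize L)" .
  qed
qed

lemma ptime_dfoldl_growth:
  assumes "ptime f" "ptime g"
    and "ptime (\<lambda>z. H (dhd z) (dhd (dtl z)) (dtl (dtl z)))"
    and "\<And>d x a. dsize (H d x a) \<le> dsize a + poly p (dsize d + dsize x)"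
  shows "ptime (\<lambda>d. dfoldl (H d) (g d) (f d))"
  using ptime_dfoldr_growth[OF ptime_drev[OF assms(1)] assms(2-4)] by (simp add: dfoldr_drev)

section \<open>List operations in polynomial time\<close>

definition dmap :: "(data \<Rightarrow> data) \<Rightarrow> data \<Rightarrow> data" where
  "dmap F = dfoldr (\<lambda>x. Node (F x)) Leaf"

definition dappend :: "data \<Rightarrow> data \<Rightarrow> data" where
  "dappend L M = dfoldr Node M L"

definition drepeat :: "nat \<Rightarrow> data \<Rightarrow> data" where
  "drepeat k = dfoldr (\<lambda>x. Node x ^^ k) Leaf"

text \<open>Only the length of \<open>K\<close> matters, so \<open>K\<close> acts as a unary number.
  A result \<open>Leaf\<close> means that \<open>L\<close> is no longer than \<open>K\<close>; all
  comparisons of lengths and indices below use this.\<close>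

definition ddrop :: "data \<Rightarrow> data \<Rightarrow> data" where
  "ddrop K L = dfoldl (\<lambda>_. dtl) L K"

lemma ptime_dmap:
  assumes "ptime f" "ptime (\<lambda>z. F (dhd z) (dtl z))"
  shows "ptime (\<lambda>d. dmap (F d) (f d))"
proof -
  from ptime_poly_boundedE[OF assms(2)]
  obtain q where q: "\<And>z. dsize (F (dhd z) (dtl z)) \<le> poly q (dsize z)"
    by blast
  have "ptime (\<lambda>z. F (dhd (Node (dhd z) (dhd (dtl z)))) (dtl (Node (dhd z) (dhd (dtl z)))))"
    by (rule ptime_comp[OF _ assms(2)]) (intro ptime_basic_intros)
  then have F: "ptime (\<lambda>z. F (dhd z) (dhd (dtl z)))"
    by simp
  show ?thesis unfolding dmap_def
  \<comment> \<open>\<open>F\<close> is bounded in terms of the pair of parameter and entry, which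
    has one node more than the two together; composing with \<open>[:1, 1:]\<close> accounts for it.
    The other 1 is the new list cell.\<close>
  proof (rule ptime_dfoldr_growth[where H = "\<lambda>d x. Node (F d x)" and p = "1 + pcompose q [:1, 1:]"])
    show "dsize (Node (F d x) a) \<le> dsize a + poly (1 + q \<circ>\<^sub>p [:1, 1:]) (dsize d + dsize x)" for d x a
      using q[of "Node d x"] by (simp add: poly_pcompose)
  qed (intro ptime_basic_intros assms F)+
qed

lemma ptime_dappend:
  assumes "ptime f" "ptime g"
  shows "ptime (\<lambda>d. dappend (f d) (g d))"
  unfolding dappend_def
proof (rule ptime_dfoldr_growth[where H = "\<lambda>_. Node" and p = "[:1, 1:]"])
  show "dsize (Node x a) \<le> dsize a + poly [:1, 1:] (dsize d + dsize x)" for d x a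
    by simp
qed (intro ptime_basic_intros assms)+

lemma ptime_funpow_Node:
  assumes "ptime f" "ptime g"
  shows "ptime (\<lambda>d. (Node (f d) ^^ k) (g d))"
  by (induction k) (auto intro: assms ptime_Node)

lemma ptime_drepeat:
  assumes "ptime f"
  shows "ptime (\<lambda>d. drepeat k (f d))"
  unfolding drepeat_def
proof (rule ptime_dfoldr_growth[where H = "\<lambda>_ x. Node x ^^ k" and p = "[:k, k:]"])
  show "dsize ((Node x ^^ k) a) \<le> dsize a + poly [:k, k:] (dsize d + dsize x)" for d x a
    by (induction k) (auto simp: algebra_simps)
qed (intro ptime_funpow_Node ptime_basic_intros assms)+

lemma ptime_ddrop:
  assumes "ptime f" "ptime g"
  shows "ptime (\<lambda>d. ddrop (f d) (g d))"
  unfolding ddrop_def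
proof (rule ptime_dfoldl_growth[where H = "\<lambda>_ _. dtl" and p = 0])
  show "dsize (dtl a) \<le> dsize a + poly 0 (dsize d + dsize x)" for d x a
    by (simp add: dsize_dhd_dtl_le)
qed (intro ptime_basic_intros assms)+

lemmas ptime_intros = ptime_basic_intros ptime_if_Leaf ptime_if_eq ptime_drev ptime_dmap
  ptime_dappend ptime_drepeat ptime_ddrop

lemma enc_list_simps [simp]:
  "enc_list f [] = Leaf"
  "enc_list f (x # xs) = Node (f x) (enc_list f xs)"
  by (simp_all add: enc_list_def)

lemma dfoldr_enc_list: "dfoldr H a (enc_list f xs) = foldr (\<lambda>x. H (f x)) xs a"
  by (induction xs) auto

lemma dmap_enc_list: "dmap F (enc_list f xs) = enc_list (\<lambda>x. F (f x)) xs"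
  by (induction xs) (auto simp: dmap_def)

lemma dappend_enc_list: "dappend (enc_list f xs) (enc_list f ys) = enc_list f (xs @ ys)"
  by (induction xs) (auto simp: dappend_def)

lemma drepeat_enc_list: "drepeat k (enc_list f xs) = enc_list f (concat (map (replicate k) xs))"
proof -
  have *: "(Node (f x) ^^ k) (enc_list f ys) = enc_list f (replicate k x @ ys)" for x ys
    by (induction k) auto
  show ?thesis
    unfolding drepeat_def dfoldr_enc_list by (induction xs) (auto simp: *)
qed

lemma enc_unary_eq_enc_list: "enc_unary n = enc_list (\<lambda>_. Leaf) (replicate n ())"
  by (induction n) auto

lemma ddrop_Leaf: "ddrop K Leaf = Leaf"
  by (induction K) (auto simp: ddrop_def)

lemma ddrop_enc_list: "ddrop (enc_list f xs) (enc_list g ys) = enc_list g (drop (length xs) ys)"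
proof (induction xs arbitrary: ys)
  case (Cons x xs)
  then show ?case
    using ddrop_Leaf[of "enc_list f xs"] by (cases ys) (auto simp: ddrop_def)
qed (simp add: ddrop_def)

lemma ddrop_enc_unary: "ddrop (enc_unary n) (enc_list g ys) = enc_list g (drop n ys)"
  by (simp add: enc_unary_eq_enc_list ddrop_enc_list)

lemma enc_list_eq_Leaf_iff: "enc_list f xs = Leaf \<longleftrightarrow> xs = []"
  by (cases xs) auto

section \<open>Registers touched by a program, and reductions between problems\<close>

fun expr_bound :: "expr \<Rightarrow> nat" where
  "expr_bound (Var x) = Suc x"
| "expr_bound Nl = 0"
| "expr_bound (Cns e f) = max (expr_bound e) (expr_bound f)"
| "expr_bound (Hd e) = expr_bound e"
| "expr_bound (Tl e) = expr_bound e"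
| "expr_bound (Eq e f) = max (expr_bound e) (expr_bound f)"

fun com_bound :: "com \<Rightarrow> nat" where
  "com_bound (Assign x e) = max (Suc x) (expr_bound e)"
| "com_bound (Seq c d) = max (com_bound c) (com_bound d)"
| "com_bound (Cond e c d) = max (expr_bound e) (max (com_bound c) (com_bound d))"
| "com_bound (While e c) = max (expr_bound e) (com_bound c)"

lemma eval_cong: "expr_bound e \<le> N \<Longrightarrow> (\<And>x. x < N \<Longrightarrow> r x = s x) \<Longrightarrow> eval r e = eval s e"
  by (induction e) auto

lemma ecost_cong: "expr_bound e \<le> N \<Longrightarrow> (\<And>x. x < N \<Longrightarrow> r x = s x) \<Longrightarrow> ecost r e = ecost s e"
proof (induction e)
  case (Eq e f)
  then show ?case using eval_cong[of e N r s] eval_cong[of f N r s] by simp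
next
  case (Cns e f)
  then show ?case using eval_cong[of e N r s] eval_cong[of f N r s] by simp
next
  case (Hd e)
  then show ?case using eval_cong[of e N r s] by simp
next
  case (Tl e)
  then show ?case using eval_cong[of e N r s] by simp
qed auto

text \<open>An arbitrary program neither reads nor writes registers beyond its bound. It therefore
  behaves as if started in the initial store even when these hold other data, and a copy of the
  input kept there survives the run.\<close>

lemma exec_frame:
  assumes "exec c s t s'" "com_bound c \<le> N" "\<And>x. x < N \<Longrightarrow> r x = s x"
  shows "\<exists>r'. exec c r t r' \<and> (\<forall>x<N. r' x = s' x) \<and> (\<forall>x\<ge>N. r' x = r x)"
  using assms
proof (induction arbitrary: r rule: exec.induct)
  case (Assign x e s)
  then have "ecost r e = ecost s e" "eval r e = eval s e"
    by (auto intro: ecost_cong eval_cong)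
  with exec.Assign[of x e r] Assign.prems show ?case
    by (intro exI[of _ "r(x := eval s e)"]) (auto simp del: fun_upd_apply, auto)
next
  case (Seq c s t s' d t' s'')
  from Seq.IH(1)[of r] Seq.prems obtain r1 where r1: "exec c r t r1"
    "\<And>x. x < N \<Longrightarrow> r1 x = s' x" "\<And>x. x \<ge> N \<Longrightarrow> r1 x = r x"
    by auto
  from Seq.IH(2)[of r1] Seq.prems r1 obtain r2 where r2: "exec d r1 t' r2"
    "\<And>x. x < N \<Longrightarrow> r2 x = s'' x" "\<And>x. x \<ge> N \<Longrightarrow> r2 x = r1 x"
    by auto
  from exec.Seq[OF r1(1) r2(1)] r1 r2 show ?case
    by auto
next
  case (CondT s e c t s' d)
  then have e: "ecost r e = ecost s e" "eval r e = eval s e"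
    using ecost_cong[of e N r s] eval_cong[of e N r s] by simp_all
  from CondT.IH[of r] CondT.prems obtain r1 where r1: "exec c r t r1"
    "\<And>x. x < N \<Longrightarrow> r1 x = s' x" "\<And>x. x \<ge> N \<Longrightarrow> r1 x = r x"
    by auto
  with exec.CondT[of r e c t r1 d] e CondT.hyps show ?case
    by auto
next
  case (CondF s e d t s' c)
  then have e: "ecost r e = ecost s e" "eval r e = eval s e"
    using ecost_cong[of e N r s] eval_cong[of e N r s] by simp_all
  from CondF.IH[of r] CondF.prems obtain r1 where r1: "exec d r t r1"
    "\<And>x. x < N \<Longrightarrow> r1 x = s' x" "\<And>x. x \<ge> N \<Longrightarrow> r1 x = r x"
    by auto
  with exec.CondF[of r e d t r1 c] e CondF.hyps show ?case
    by auto
next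
  case (WhileF s e c)
  then have e: "ecost r e = ecost s e" "eval r e = eval s e"
    using ecost_cong[of e N r s] eval_cong[of e N r s] by simp_all
  with exec.WhileF[of r e c] WhileF show ?case
    by auto
next
  case (WhileT s e c t s' t' s'')
  then have e: "ecost r e = ecost s e" "eval r e = eval s e"
    using ecost_cong[of e N r s] eval_cong[of e N r s] by simp_all
  from WhileT.IH(1)[of r] WhileT.prems obtain r1 where r1: "exec c r t r1"
    "\<And>x. x < N \<Longrightarrow> r1 x = s' x" "\<And>x. x \<ge> N \<Longrightarrow> r1 x = r x"
    by auto
  from WhileT.IH(2)[of r1] WhileT.prems r1 obtain r2 where r2: "exec (While e c) r1 t' r2"
    "\<And>x. x < N \<Longrightarrow> r2 x = s'' x" "\<And>x. x \<ge> N \<Longrightarrow> r2 x = r1 x"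
    by auto
  from exec.WhileT[of r e c t r1 t' r2] r1 r2 e WhileT.hyps show ?case
    by auto
qed

text \<open>The preprocessing program runs above the registers of the given program, which therefore
  finds its own registers in their initial state.\<close>

lemma poly_time_solvable_reduction:
  assumes solvable: "poly_time_solvable InstJ encJ corrJ"
    and pre: "ptime pre" and post: "ptime post"
    and red: "\<And>I. I \<in> Inst \<Longrightarrow> \<exists>J\<in>InstJ. pre (enc I) = encJ J \<and>
      (\<forall>d. corrJ J d \<longrightarrow> corr I (post (Node (enc I) d)))"
  shows "poly_time_solvable Inst enc corr"
proof -
  from solvable obtain c and q :: "nat poly" where c: "\<And>J. J \<in> InstJ \<Longrightarrow>
      \<exists>t s. exec c (init_store (encJ J)) t s \<and> t \<le> poly q (dsize (encJ J)) \<and> corrJ J (s 0)"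
    unfolding poly_time_solvable_def by blast
  from pre obtain T e where T: "poly_bounded T"
    and e: "\<And>b s. runs (e b) s (T (s b)) (\<lambda>s'. s' b = pre (s b) \<and> (\<forall>x<b. s' x = s x))"
    by (rule ptimeE) blast
  from post obtain U k where U: "poly_bounded U"
    and k: "\<And>b s. runs (k b) s (U (s b)) (\<lambda>s'. s' b = post (s b) \<and> (\<forall>x<b. s' x = s x))"
    by (rule ptimeE) blast
  from U obtain u where u: "\<And>d. U d \<le> poly u (dsize d)"
    by (auto simp: poly_bounded_def)
  from ptime_poly_boundedE[OF post] obtain v where v: "\<And>d. dsize (post d) \<le> poly v (dsize d)"
    by blast
  \<comment> \<open>Register \<open>N\<close> keeps the input for postprocessing; the successor
    makes it differ from register 0.\<close>
  define N where "N = Suc (com_bound c)"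
  define P where "P = (\<lambda>d. dsize (pre d))"
  define R where "R = (\<lambda>d. poly q (P d))"
  \<comment> \<open>Bounds the argument of postprocessing, the pair of input and output of
    \<open>c\<close>: that output is no larger than its input plus its running time.\<close>
  define Z where "Z = (\<lambda>d. Suc (dsize d + (1 + P d + R d)))"
  define total where "total = (\<lambda>d. dsize d + ((dsize d + T d) + (P d + (R d +
    ((3 * Z d + poly u (Z d)) + poly v (Z d))))))"
  have "poly_bounded total"
    unfolding total_def Z_def R_def P_def Suc_eq_plus1
    by (intro poly_bounded_intros T ptime_poly_bounded pre)
  then obtain r where r: "\<And>d. total d \<le> poly r (dsize d)"
    by (auto simp: poly_bounded_def)
  define prog where "prog = Seq (Assign N (Var 0)) (Seq (Seq (Assign (N + 1) (Var N)) (e (N + 1)))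
    (Seq (Assign 0 (Var (N + 1))) (Seq c
    (Seq (Seq (Assign (N + 1) (Cns (Var N) (Var 0))) (k (N + 1))) (Assign 0 (Var (N + 1)))))))"
  have "\<exists>t s. exec prog (init_store (enc I)) t s \<and> t \<le> poly r (dsize (enc I)) \<and> corr I (s 0)"
    if I: "I \<in> Inst" for I
  proof -
    let ?d = "enc I"
    from red[OF I] obtain J where J: "J \<in> InstJ" "pre ?d = encJ J"
      and corr: "\<And>d. corrJ J d \<Longrightarrow> corr I (post (Node ?d d))"
      by blast
    from c[OF J(1)] obtain t s where s: "exec c (init_store (pre ?d)) t s"
      "t \<le> R ?d" "corrJ J (s 0)"
      unfolding J(2)[symmetric] R_def P_def by blast
    have "dsize (s 0) \<le> dsize (pre ?d) + t"
      using exec_dsize_le[OF s(1), of 0] by (simp add: init_store_def)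
    then have Z: "dsize (Node ?d (s 0)) \<le> Z ?d"
      using s(2) by (simp add: Z_def P_def)
    have N: "0 < N" "com_bound c \<le> N"
      by (auto simp: N_def)
    have frame: "runs c s1 (R ?d) (\<lambda>s'. s' 0 = s 0 \<and> s' N = ?d)"
      if "\<And>x. x < N \<Longrightarrow> s1 x = init_store (pre ?d) x" "s1 N = ?d" for s1
      using exec_frame[OF s(1) N(2) that(1)] that(2) s(2) N unfolding runs_def by fastforce
    have "runs prog (init_store ?d) (ecost (init_store ?d) (Var 0) + ((dsize ?d + T ?d) + (P ?d + (R ?d +
      ((3 * Z ?d + poly u (Z ?d)) + poly v (Z ?d)))))) (\<lambda>s'. s' 0 = post (Node ?d (s 0)))"
      unfolding prog_def
    proof (rule runs_Assign_Seq, rule runs_Seq[OF runs_mono[OF runs_call[OF e]]])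
      fix s1
      assume "s1 (N + 1) = pre (eval ((init_store ?d)(N := eval (init_store ?d) (Var 0))) (Var N)) \<and>
        (\<forall>x<N + 1. s1 x = ((init_store ?d)(N := eval (init_store ?d) (Var 0))) x)"
      then have s1: "s1 (N + 1) = pre ?d" "s1 N = ?d" "\<And>x. x < N \<Longrightarrow> s1 x = init_store ?d x"
        by (auto simp: init_store_def)
      have "runs (Seq (Assign 0 (Var (N + 1))) (Seq c
        (Seq (Seq (Assign (N + 1) (Cns (Var N) (Var 0))) (k (N + 1))) (Assign 0 (Var (N + 1))))))
        s1 (ecost s1 (Var (N + 1)) + (R ?d + ((3 * Z ?d + poly u (Z ?d)) + poly v (Z ?d))))
        (\<lambda>s'. s' 0 = post (Node ?d (s 0)))"
      proof (rule runs_Assign_Seq, rule runs_Seq[OF frame])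
        show "(s1(0 := eval s1 (Var (N + 1)))) x = init_store (pre ?d) x" if "x < N" for x
          using that s1 by (auto simp: init_store_def)
        show "(s1(0 := eval s1 (Var (N + 1)))) N = ?d"
          using s1 N by auto
        fix s2 assume s2: "s2 0 = s 0 \<and> s2 N = ?d"
        have cost: "dsize (s2 N) + dsize (s2 0) + dsize (Node (s2 N) (s2 0)) +
          U (Node (s2 N) (s2 0)) \<le> 3 * Z ?d + poly u (Z ?d)"
          using Z s2 order_trans[OF u poly_nat_mono[OF Z]] by simp
        show "runs (Seq (Seq (Assign (N + 1) (Cns (Var N) (Var 0))) (k (N + 1)))
          (Assign 0 (Var (N + 1)))) s2 ((3 * Z ?d + poly u (Z ?d)) + poly v (Z ?d))
          (\<lambda>s'. s' 0 = post (Node ?d (s 0)))"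
          apply (rule runs_Seq[OF runs_mono[OF runs_call[OF k]]])
            apply (use cost in simp)
           apply assumption
          apply (rule runs_Assign)
          using s2 order_trans[OF v poly_nat_mono[OF Z]] by auto
      qed
      then show "runs (Seq (Assign 0 (Var (N + 1))) (Seq c
        (Seq (Seq (Assign (N + 1) (Cns (Var N) (Var 0))) (k (N + 1))) (Assign 0 (Var (N + 1))))))
        s1 (P ?d + (R ?d + ((3 * Z ?d + poly u (Z ?d)) + poly v (Z ?d))))
        (\<lambda>s'. s' 0 = post (Node ?d (s 0)))"
        using s1 by (simp add: P_def)
    qed (simp_all add: init_store_def)
    then have "runs prog (init_store ?d) (total ?d) (\<lambda>s'. s' 0 = post (Node ?d (s 0)))"
      unfolding total_def by (simp add: init_store_def)
    with corr[OF s(3)] r[of ?d] show ?thesis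
      unfolding runs_def by (metis order_trans)
  qed
  then show ?thesis
    unfolding poly_time_solvable_def by blast
qed

section \<open>Repetition of list entries and blocks of consecutive indices\<close>

definition repeat_each :: "nat \<Rightarrow> 'a list \<Rightarrow> 'a list" where
  "repeat_each k xs = concat (map (replicate k) xs)"

lemma repeat_each_simps [simp]:
  "repeat_each k [] = []"
  "repeat_each k (x # xs) = replicate k x @ repeat_each k xs"
  by (simp_all add: repeat_each_def)

lemma length_repeat_each [simp]: "length (repeat_each k xs) = length xs * k"
  by (induction xs) auto

lemma set_repeat_each: "0 < k \<Longrightarrow> set (repeat_each k xs) = set xs"
  by (induction xs) auto

lemma nth_repeat_each: "i < length xs * k \<Longrightarrow> repeat_each k xs ! i = xs ! (i div k)"
proof (induction xs arbitrary: i)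
  case (Cons x xs)
  show ?case
  proof (cases "i < k")
    case False
    with Cons.prems have "0 < k"
      by (cases k) auto
    with False have "i div k = Suc ((i - k) div k)"
      by (simp add: le_div_geq)
    moreover have "i - k < length xs * k"
      using Cons.prems False by (auto simp: algebra_simps)
    ultimately show ?thesis
      using False Cons.IH[of "i - k"] by (simp add: nth_append)
  qed (simp add: nth_append)
qed simp

text \<open>The positions of the \<open>k\<close> copies of entry \<open>t\<close> in a list
  produced by \<open>repeat_each k\<close>.\<close>

definition block :: "nat \<Rightarrow> nat \<Rightarrow> nat set" where
  "block k t = {t * k..<t * k + k}"

lemma block_iff: "0 < k \<Longrightarrow> j \<in> block k t \<longleftrightarrow> j div k = t"
  unfolding block_def
  using div_times_less_eq_dividend[of j k] dividend_less_div_times[of k j]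
  by (auto simp: algebra_simps intro!: div_nat_eqI)

lemma card_block [simp]: "card (block k t) = k" and finite_block [simp]: "finite (block k t)"
  by (simp_all add: block_def)

lemma block_disjoint: "t \<noteq> u \<Longrightarrow> block k t \<inter> block k u = {}"
  by (cases "k = 0") (auto simp: block_def[of 0] block_iff)

lemma div_less_iff: "0 < k \<Longrightarrow> j div k < n \<longleftrightarrow> j < n * (k::nat)"
  by (simp add: less_mult_imp_div_less div_less_iff_less_mult)

lemma UN_block: "(\<Union>t<n. block k t) = {..<n * k}"
proof (cases "k = 0")
  case False
  then show ?thesis
    by (auto simp: block_iff div_less_iff)
qed (auto simp: block_def)

lemma block_subset: "t < n \<Longrightarrow> block k t \<subseteq> {..<n * k}"
  using UN_block[where n = n and k = k] by blast

lemma sum_block: "(\<Sum>t<n. \<Sum>j\<in>block k t. f j) = sum f {..<n * k}"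
  unfolding block_def by (rule sum.nat_group)

lemma card_UN_block: "finite S \<Longrightarrow> card (\<Union>t\<in>S. block k t) = card S * k"
  by (subst card_UN_disjoint) (simp_all add: block_disjoint)

lemma feasibleD:
  assumes "feasible \<kappa> I A"
  shows "t < num_treat I \<Longrightarrow> A t \<subseteq> {..<num_ctrl I}"
    and "t < num_treat I \<Longrightarrow> card (A t) = \<kappa>"
    and "t < num_treat I \<Longrightarrow> finite (A t)"
    and "t < num_treat I \<Longrightarrow> u < num_treat I \<Longrightarrow> t \<noteq> u \<Longrightarrow> A t \<inter> A u = {}"
    and "p \<in> {1, 2} \<Longrightarrow> i < num_levels I p \<Longrightarrow>
      card ((\<Union>t<num_treat I. A t) \<inter> ctrl_part I p i) = \<kappa> * card (treat_part I p i)"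
  using assms finite_subset[of "A t" "{..<num_ctrl I}"] unfolding feasible_def by auto

lemma feasibleI:
  assumes "\<And>t. t < num_treat I \<Longrightarrow> A t \<subseteq> {..<num_ctrl I}"
    and "\<And>t. t < num_treat I \<Longrightarrow> card (A t) = \<kappa>"
    and "\<And>t u. t < num_treat I \<Longrightarrow> u < num_treat I \<Longrightarrow> t \<noteq> u \<Longrightarrow> A t \<inter> A u = {}"
    and "\<And>p i. p \<in> {1, 2} \<Longrightarrow> i < num_levels I p \<Longrightarrow>
      card ((\<Union>t<num_treat I. A t) \<inter> ctrl_part I p i) = \<kappa> * card (treat_part I p i)"
  shows "feasible \<kappa> I A"
  unfolding feasible_def by (intro conjI allI impI ballI assms)

lemma feasible_cong:
  assumes "\<And>t. t < num_treat I \<Longrightarrow> A t = B t"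
  shows "feasible \<kappa> I A \<longleftrightarrow> feasible \<kappa> I B"
proof -
  have "(\<Union>t<num_treat I. A t) = (\<Union>t<num_treat I. B t)"
    by (intro SUP_cong) (auto simp: assms)
  then show ?thesis
    unfolding feasible_def by (simp add: assms)
qed

lemma cost_cong: "(\<And>t. t < num_treat I \<Longrightarrow> A t = B t) \<Longrightarrow> cost I A = cost I B"
  unfolding cost_def by (intro sum.cong) auto

lemma optimal_cong:
  assumes "\<And>t. t < num_treat I \<Longrightarrow> A t = B t"
  shows "optimal \<kappa> I A \<longleftrightarrow> optimal \<kappa> I B"
proof -
  have "feasible \<kappa> I A \<longleftrightarrow> feasible \<kappa> I B"
    by (rule feasible_cong) (rule assms)
  moreover have "cost I A = cost I B"
    by (rule cost_cong) (rule assms)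
  ultimately show ?thesis
    by (simp add: optimal_def)
qed

section \<open>Repeating the treatment samples\<close>

definition repeat_treatments :: "nat \<Rightarrow> 'd bm \<Rightarrow> 'd bm" where
  "repeat_treatments k I = I\<lparr>treat := repeat_each k (treat I), dist := repeat_each k (dist I)\<rparr>"

definition merge_blocks :: "nat \<Rightarrow> (nat \<Rightarrow> 'a set) \<Rightarrow> nat \<Rightarrow> 'a set" where
  "merge_blocks k B t = (\<Union>j\<in>block k t. B j)"

lemma repeat_treatments_simps [simp]:
  "num_treat (repeat_treatments k I) = num_treat I * k"
  "num_ctrl (repeat_treatments k I) = num_ctrl I"
  "num_levels (repeat_treatments k I) p = num_levels I p"
  "ctrl_part (repeat_treatments k I) p i = ctrl_part I p i"
  by (simp_all add: repeat_treatments_def num_treat_def num_ctrl_def num_levels_def ctrl_part_def)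

lemma UN_merge_blocks: "(\<Union>t<n. merge_blocks k B t) = (\<Union>j<n * k. B j)"
  unfolding merge_blocks_def UN_block[symmetric] by blast

context
  fixes k :: nat and I :: "'d :: {comm_monoid_add, linorder} bm"
  assumes k: "0 < k" and wf: "well_formed I"
begin

lemma treat_part_repeat:
  "treat_part (repeat_treatments k I) p i = (\<Union>t\<in>treat_part I p i. block k t)"
proof -
  have *: "treat (repeat_treatments k I) ! j = treat I ! (j div k)" if "j < num_treat I * k" for j
    using that by (simp add: repeat_treatments_def num_treat_def nth_repeat_each)
  show ?thesis
    using k by (auto simp: treat_part_def block_iff div_less_iff *)
qed

lemma card_treat_part_repeat:
  "card (treat_part (repeat_treatments k I) p i) = k * card (treat_part I p i)"
  unfolding treat_part_repeat by (subst card_UN_block) (auto simp: treat_part_def)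

lemma delta_repeat:
  "j < num_treat I * k \<Longrightarrow> delta (repeat_treatments k I) j c = delta I (j div k) c"
  using wf by (simp add: repeat_treatments_def num_treat_def delta_def nth_repeat_each well_formed_def)

text \<open>Merging leaves the set of used controls unchanged, and the factor \<open>k\<close> in
  the demand of a level is the factor by which its treatment part was enlarged.\<close>

lemma feasible_merge_blocks:
  assumes "feasible 1 (repeat_treatments k I) B"
  shows "feasible k I (merge_blocks k B)"
proof (rule feasibleI)
  note B = feasibleD[OF assms, simplified]
  fix t assume t: "t < num_treat I"
  then have block: "j < num_treat I * k" if "j \<in> block k t" for j
    using block_subset[OF t, of k] that by auto
  show "merge_blocks k B t \<subseteq> {..<num_ctrl I}"
    using B(1) block by (auto simp: merge_blocks_def)
  have "card (merge_blocks k B t) = (\<Sum>j\<in>block k t. card (B j))"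
    unfolding merge_blocks_def using B(3,4) block by (intro card_UN_disjoint) auto
  then show "card (merge_blocks k B t) = k"
    using B(2) block by simp
  fix u assume "u < num_treat I" "t \<noteq> u"
  then show "merge_blocks k B t \<inter> merge_blocks k B u = {}"
    using block block_subset[of u "num_treat I" k] B(4) block_disjoint[of t u k]
    unfolding merge_blocks_def disjoint_iff UN_iff lessThan_iff subset_iff by (metis B(4) disjoint_iff)
next
  fix p i assume "p \<in> {1, 2 :: nat}" "i < num_levels I p"
  then show "card ((\<Union>t<num_treat I. merge_blocks k B t) \<inter> ctrl_part I p i) = k * card (treat_part I p i)"
    using feasibleD(5)[OF assms, of p i] by (simp add: UN_merge_blocks card_treat_part_repeat)
qed

lemma cost_merge_blocks:
  assumes "feasible 1 (repeat_treatments k I) B"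
  shows "cost I (merge_blocks k B) = cost (repeat_treatments k I) B"
proof -
  note B = feasibleD[OF assms, simplified]
  have "(\<Sum>c\<in>merge_blocks k B t. delta I t c) =
    (\<Sum>j\<in>block k t. \<Sum>c\<in>B j. delta (repeat_treatments k I) j c)" if "t < num_treat I" for t
  proof -
    have block: "j < num_treat I * k" "j div k = t" if "j \<in> block k t" for j
      using block_subset[OF \<open>t < num_treat I\<close>, of k] that k by (auto simp: block_iff)
    have "(\<Sum>c\<in>merge_blocks k B t. delta I t c) = (\<Sum>j\<in>block k t. \<Sum>c\<in>B j. delta I t c)"
      unfolding merge_blocks_def using B(3,4) block by (intro sum.UNION_disjoint) auto
    then show ?thesis
      by (simp add: delta_repeat block)
  qed
  then show ?thesis
    unfolding cost_def by (simp add: sum_block)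
qed

text \<open>Any enumeration of \<open>A t\<close> distributes its members over the \<open>k\<close>
  copies of \<open>t\<close>. The choice does not affect the cost because all copies have the same
  distances. This direction provides the competitors for optimality and transfers
  infeasibility.\<close>

lemma feasible_split_blocks:
  assumes "feasible k I A"
  obtains B where "feasible 1 (repeat_treatments k I) B"
    "\<And>t. t < num_treat I \<Longrightarrow> merge_blocks k B t = A t"
proof -
  note A = feasibleD[OF assms]
  have "\<exists>e. bij_betw e {0..<k} (A t)" if "t < num_treat I" for t
    using ex_bij_betw_nat_finite[OF A(3)[OF that]] A(2)[OF that] by auto
  then obtain e where e: "\<And>t. t < num_treat I \<Longrightarrow> bij_betw (e t) {0..<k} (A t)"
    by metis
  \<comment> \<open>The quotient selects the sample, the remainder the copy of it.\<close>
  define B where "B = (\<lambda>j. {e (j div k) (j mod k)})"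
  have merge: "merge_blocks k B t = A t" if t: "t < num_treat I" for t
  proof -
    have "merge_blocks k B t = e t ` {0..<k}"
    proof (intro equalityI subsetI)
      fix c assume "c \<in> e t ` {0..<k}"
      then obtain i where "i < k" "c = e t i"
        by auto
      then have "t * k + i \<in> block k t" "c \<in> B (t * k + i)"
        using k by (auto simp: block_def B_def)
      then show "c \<in> merge_blocks k B t"
        unfolding merge_blocks_def by blast
    qed (use k in \<open>auto simp: merge_blocks_def B_def block_iff\<close>)
    with e[OF t] show ?thesis
      by (simp add: bij_betw_def)
  qed
  have in_A: "e (j div k) (j mod k) \<in> A (j div k)" if "j < num_treat I * k" for j
    using e[of "j div k"] that k by (auto simp: div_less_iff bij_betw_def)
  have "feasible 1 (repeat_treatments k I) B"
  proof (rule feasibleI)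
    fix j assume j: "j < num_treat (repeat_treatments k I)"
    then show "B j \<subseteq> {..<num_ctrl (repeat_treatments k I)}"
      using in_A[of j] A(1)[of "j div k"] k by (auto simp: B_def div_less_iff)
    show "card (B j) = 1"
      by (simp add: B_def)
    fix l assume l: "l < num_treat (repeat_treatments k I)" "j \<noteq> l"
    show "B j \<inter> B l = {}"
    proof (cases "j div k = l div k")
      case True
      with l(2) have "j mod k \<noteq> l mod k"
        by (metis div_mult_mod_eq)
      moreover have "inj_on (e (j div k)) {0..<k}"
        using e[of "j div k"] j k by (simp add: div_less_iff bij_betw_def)
      ultimately show ?thesis
        using True k by (auto simp: B_def dest: inj_onD)
    next
      case False
      then show ?thesis
        using in_A[of j] in_A[of l] A(4)[of "j div k" "l div k"] j l k
        by (auto simp: B_def div_less_iff)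
    qed
  next
    fix p i assume "p \<in> {1, 2 :: nat}" "i < num_levels (repeat_treatments k I) p"
    moreover have "(\<Union>j<num_treat I * k. B j) = (\<Union>t<num_treat I. A t)"
      unfolding UN_merge_blocks[symmetric] by (intro SUP_cong) (auto simp: merge)
    ultimately show "card ((\<Union>j<num_treat (repeat_treatments k I). B j) \<inter>
      ctrl_part (repeat_treatments k I) p i) = 1 * card (treat_part (repeat_treatments k I) p i)"
      using A(5)[of p i] by (simp add: card_treat_part_repeat)
  qed
  with merge show ?thesis
    using that by blast
qed

lemma optimal_merge_blocks:
  assumes "optimal 1 (repeat_treatments k I) B"
  shows "optimal k I (merge_blocks k B)"
  unfolding optimal_def
proof (intro conjI allI impI)
  from assms have B: "feasible 1 (repeat_treatments k I) B"
    by (simp add: optimal_def)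
  then show "feasible k I (merge_blocks k B)"
    by (rule feasible_merge_blocks)
  fix A assume "feasible k I A"
  then obtain B' where B': "feasible 1 (repeat_treatments k I) B'"
    "\<And>t. t < num_treat I \<Longrightarrow> merge_blocks k B' t = A t"
    by (rule feasible_split_blocks) blast
  have "cost I (merge_blocks k B) \<le> cost I (merge_blocks k B')"
    using assms B'(1) by (simp add: cost_merge_blocks B optimal_def)
  also have "\<dots> = cost I A"
    by (rule cost_cong) (rule B'(2))
  finally show "cost I (merge_blocks k B) \<le> cost I A" .
qed

end

section \<open>Merging answers, on lists and on trees\<close>

fun concat_groups :: "nat \<Rightarrow> nat \<Rightarrow> 'a list list \<Rightarrow> 'a list list" where
  "concat_groups k 0 xss = []"
| "concat_groups k (Suc n) xss = concat (take k xss) # concat_groups k n (drop k xss)"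

lemma length_concat_groups [simp]: "length (concat_groups k n xss) = n"
  by (induction n arbitrary: xss) auto

lemma nth_concat_groups: "t < n \<Longrightarrow> concat_groups k n xss ! t = concat (take k (drop (t * k) xss))"
proof (induction n arbitrary: t xss)
  case (Suc n)
  then show ?case by (cases t) (auto simp: add.commute)
qed simp

definition merge_answer :: "nat \<Rightarrow> 'd bm \<Rightarrow> answer \<Rightarrow> answer" where
  "merge_answer k I = map_option (concat_groups k (num_treat I))"

lemma take_drop_conv_nth: 
  "a + k \<le> length xs \<Longrightarrow> take k (drop a xs) = map ((!) xs) [a..<a + k]"
  by (intro nth_equalityI) auto

lemma solution_merge_answer:
  fixes I :: "'d :: {comm_monoid_add, linorder} bm"
  assumes k: "0 < k" and wf: "well_formed I" and sol: "solution 1 (repeat_treatments k I) ans"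
  shows "solution k I (merge_answer k I ans)"
proof (cases ans)
  case None
  with sol feasible_split_blocks[OF k wf] show ?thesis
    by (fastforce simp: solution_def merge_answer_def)
next
  case (Some xss)
  let ?n = "num_treat I"
  from sol Some have len: "length xss = ?n * k" and dist: "\<forall>xs\<in>set xss. distinct xs"
    and opt: "optimal 1 (repeat_treatments k I) (\<lambda>t. set (xss ! t))"
    by (auto simp: solution_def)
  from opt have feas: "feasible 1 (repeat_treatments k I) (\<lambda>t. set (xss ! t))"
    by (simp add: optimal_def)
  have nth: "concat_groups k ?n xss ! t = concat (map ((!) xss) [t * k..<t * k + k])" if "t < ?n" for t
  proof -
    have "Suc t * k \<le> ?n * k"
      using that by (intro mult_right_mono) auto
    with that show ?thesis
      by (simp add: nth_concat_groups take_drop_conv_nth len add.commute)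
  qed
  have set: "set (concat_groups k ?n xss ! t) = merge_blocks k (\<lambda>t. set (xss ! t)) t" if "t < ?n" for t
    using that by (simp add: nth merge_blocks_def block_def)
  have "optimal k I (\<lambda>t. set (concat_groups k ?n xss ! t))"
    by (rule optimal_cong[THEN iffD1, OF _ optimal_merge_blocks[OF k wf opt]]) (simp add: set)
  \<comment> \<open>By counting: \<open>k\<close> lists of length one give \<open>k\<close> entries,
    and feasibility of the merged assignment says that their set has \<open>k\<close>
    elements.\<close>
  moreover have "distinct (concat_groups k ?n xss ! t)" if t: "t < ?n" for t
  proof (rule card_distinct)
    have 1: "length (xss ! j) = 1" if "j \<in> block k t" for j
      using feasibleD(2)[OF feas, of j] block_subset[OF t, of k] that dist len
      by (auto simp: distinct_card)
    have "length (concat_groups k ?n xss ! t) = (\<Sum>j\<in>block k t. length (xss ! j))"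
      by (simp add: nth[OF t] length_concat block_def sum_list_distinct_conv_sum_set comp_def)
    also have "\<dots> = k"
      by (simp add: 1)
    also have "\<dots> = card (set (concat_groups k ?n xss ! t))"
      using feasibleD(2)[OF feasible_merge_blocks[OF k wf feas] t] set[OF t] by simp
    finally show "card (set (concat_groups k ?n xss ! t)) = length (concat_groups k ?n xss ! t)"
      by simp
  qed
  ultimately show ?thesis
    using Some by (auto simp: solution_def merge_answer_def in_set_conv_nth)
qed

fun dgather :: "nat \<Rightarrow> data \<Rightarrow> data" where
  "dgather 0 r = Leaf"
| "dgather (Suc k) r = dappend (dhd r) (dgather k (dtl r))"

text \<open>The accumulator pairs the lists still to be grouped with the groups made so far, latest
  first.\<close>

definition group_step :: "nat \<Rightarrow> data \<Rightarrow> data" where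
  "group_step k a = Node ((dtl ^^ k) (dhd a)) (Node (dgather k (dhd a)) (dtl a))"

text \<open>\<open>L\<close> only counts the groups; in the reduction it is the list of treatment
  samples of the original instance.\<close>

definition dgroup :: "nat \<Rightarrow> data \<Rightarrow> data \<Rightarrow> data" where
  "dgroup k L r = drev (dtl (dfoldl (\<lambda>_. group_step k) (Node r Leaf) L))"

lemma ptime_dgather: "ptime f \<Longrightarrow> ptime (\<lambda>d. dgather k (f d))"
  by (induction k arbitrary: f) (auto intro!: ptime_intros)

lemma ptime_funpow_dtl: "ptime f \<Longrightarrow> ptime (\<lambda>d. (dtl ^^ k) (f d))"
  by (induction k) (auto intro!: ptime_intros)

lemma dsize_dappend_le: "dsize (dappend x y) \<le> dsize x + dsize y"
  by (induction x) (auto simp: dappend_def)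

text \<open>Gathering moves entries from one component of the accumulator to the other. Bounding
  both parts together shows that a grouping step grows the accumulator by a constant only, although
  the gathered lists may be long.\<close>

lemma dsize_dgather_le: "dsize (dgather k r) + dsize ((dtl ^^ k) r) \<le> dsize r + k + 1"
proof (induction k arbitrary: r)
  case (Suc k)
  show ?case
  proof (cases r)
    case Leaf
    with Suc[of Leaf] show ?thesis
      by (simp add: funpow_swap1 dappend_def)
  next
    case (Node x r')
    with Suc[of r'] dsize_dappend_le[of x "dgather k r'"] show ?thesis
      by (simp add: funpow_swap1)
  qed
qed simp

lemma ptime_dgroup:
  assumes "ptime f" "ptime g"
  shows "ptime (\<lambda>d. dgroup k (f d) (g d))"
  unfolding dgroup_def
proof (intro ptime_drev ptime_dtl,
    rule ptime_dfoldl_growth[where H = "\<lambda>_ _. group_step k" and p = "[:k + 4:]"])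
  show "dsize (group_step k a) \<le> dsize a + poly [:k + 4:] (dsize d + dsize x)" for d x a
    using dsize_dgather_le[of k "dhd a"] by (cases a) (auto simp: group_step_def)
qed (auto simp: group_step_def intro!: ptime_intros ptime_dgather ptime_funpow_dtl assms)

lemma drev_enc_list: "drev (enc_list f xs) = enc_list f (rev xs)"
proof -
  have "dfoldl Node (enc_list f ys) (enc_list f xs) = enc_list f (rev xs @ ys)" for ys
  proof (induction xs arbitrary: ys)
    case (Cons x xs)
    from Cons[of "x # ys"] show ?case
      by simp
  qed simp
  from this[of "[]"] show ?thesis
    by (simp add: dfoldl_Node)
qed

lemma dtl_enc_list: "dtl (enc_list f xs) = enc_list f (tl xs)"
  by (cases xs) auto

lemma funpow_dtl_enc_list: "(dtl ^^ k) (enc_list f xs) = enc_list f (drop k xs)"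
  by (induction k) (auto simp: dtl_enc_list tl_drop drop_Suc)

lemma dgather_enc_list:
  "dgather k (enc_list (enc_list f) xss) = enc_list f (concat (take k xss))"
proof (induction k arbitrary: xss)
  case (Suc k)
  show ?case
  proof (cases xss)
    case Nil
    with Suc[of "[]"] show ?thesis
      by (simp add: dappend_def)
  next
    case (Cons xs yss)
    with Suc show ?thesis
      by (simp add: dappend_enc_list)
  qed
qed simp

lemma dgroup_enc_list:
  "dgroup k (enc_list g ts) (enc_list (enc_list f) xss) = enc_list (enc_list f) (concat_groups k (length ts) xss)"
proof -
  let ?E = "enc_list (enc_list f)"
  have "drev (dtl (dfoldl (\<lambda>_. group_step k) (Node (?E xss) (?E yss)) (enc_list g ts))) =
    ?E (rev yss @ concat_groups k (length ts) xss)" for yss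
  proof (induction ts arbitrary: xss yss)
    case (Cons t ts)
    show ?case
      using Cons[of "drop k xss" "concat (take k xss) # yss"]
      by (simp add: group_step_def funpow_dtl_enc_list dgather_enc_list)
  qed (simp add: drev_enc_list)
  from this[of "[]"] show ?thesis
    by (simp add: dgroup_def)
qed

lemma dsize_enc_list_repeat_each:
  "0 < k \<Longrightarrow> dsize (enc_list f xs) \<le> dsize (enc_list f (repeat_each k xs))"
proof (induction xs)
  case (Cons x xs)
  have "dsize (enc_list f ys) \<le> dsize (enc_list f (replicate n x @ ys))" for n ys
    by (induction n) auto
  then have "dsize (enc_list f (x # repeat_each k xs)) \<le> dsize (enc_list f (x # replicate (k - 1) x @ repeat_each k xs))"
    by simp
  also have "x # replicate (k - 1) x @ repeat_each k xs = repeat_each k (x # xs)"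
    using Cons.prems by (cases k) auto
  finally show ?case
    using Cons by simp
qed simp

text \<open>Repeated rows bring no new distances, and the encoding, at whose length the bound is
  evaluated, does not shrink. So \<pi> itself still works.\<close>

lemma BM'_instances_repeat_treatments:
  assumes "0 < k" "I \<in> BM'_instances K \<pi>"
  shows "repeat_treatments k I \<in> BM'_instances K \<pi>"
proof -
  from assms have wf: "well_formed I" and K: "num_levels I 2 = K"
    and \<pi>: "\<And>t c. t < num_treat I \<Longrightarrow> c < num_ctrl I \<Longrightarrow> delta I t c \<le> poly \<pi> (dsize (enc_bm I))"
    by (auto simp: BM'_instances_def)
  have "well_formed (repeat_treatments k I)"
    using wf assms(1) by (simp add: well_formed_def repeat_treatments_def set_repeat_each)
  moreover have "dsize (enc_bm I) \<le> dsize (enc_bm (repeat_treatments k I))"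
    by (auto simp: enc_bm_def repeat_treatments_def intro!: add_mono
        dsize_enc_list_repeat_each[OF assms(1)])
  moreover have "delta (repeat_treatments k I) t c \<le> poly \<pi> (dsize (enc_bm I))"
    if "t < num_treat I * k" "c < num_ctrl I" for t c
    using \<pi>[of "t div k" c] that assms(1) delta_repeat[OF assms(1) wf, of t] by (simp add: div_less_iff)
  ultimately show ?thesis
    using K by (auto simp: BM'_instances_def intro: order_trans[OF _ poly_nat_mono])
qed

lemma kappa_BM'_if_BM':
  assumes "0 < \<kappa>" "BM'_poly_time K \<pi>"
  shows "kappa_BM'_poly_time \<kappa> K \<pi>"
proof -
  define pre where "pre = (\<lambda>d. Node (dhd d) (Node (dhd (dtl d)) (Node (drepeat \<kappa> (dhd (dtl (dtl d))))
    (Node (dhd (dtl (dtl (dtl d)))) (drepeat \<kappa> (dtl (dtl (dtl (dtl d)))))))))"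
  define post where "post = (\<lambda>z. if dtl z = Leaf then Leaf
    else Node (dgroup \<kappa> (dhd (dtl (dtl (dhd z)))) (dhd (dtl z))) Leaf)"
  show ?thesis
    unfolding kappa_BM'_poly_time_def
  proof (rule poly_time_solvable_reduction)
    show "poly_time_solvable (BM'_instances K \<pi>) enc_bm (\<lambda>I d. \<exists>ans. d = enc_answer ans \<and> solution 1 I ans)"
      using assms(2) by (simp add: BM'_poly_time_def kappa_BM'_poly_time_def)
    show "ptime pre" unfolding pre_def
      by (intro ptime_intros)
    show "ptime post" unfolding post_def
      by (intro ptime_intros ptime_dgroup)
    fix I assume I: "I \<in> BM'_instances K \<pi>"
    then have wf: "well_formed I"
      by (simp add: BM'_instances_def)
    have "pre (enc_bm I) = enc_bm (repeat_treatments \<kappa> I)"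
      by (simp add: pre_def enc_bm_def drepeat_enc_list repeat_treatments_def repeat_each_def)
    moreover have "post (Node (enc_bm I) (enc_answer ans)) = enc_answer (merge_answer \<kappa> I ans)" for ans
      by (cases ans) (simp_all add: post_def enc_bm_def enc_answer_def merge_answer_def
          num_treat_def dgroup_enc_list)
    ultimately show "\<exists>J\<in>BM'_instances K \<pi>. pre (enc_bm I) = enc_bm J \<and>
      (\<forall>d. (\<exists>ans. d = enc_answer ans \<and> solution 1 J ans) \<longrightarrow>
        (\<exists>ans. post (Node (enc_bm I) d) = enc_answer ans \<and> solution \<kappa> I ans))"
      using BM'_instances_repeat_treatments[OF assms(1) I] solution_merge_answer[OF assms(1) wf] by blast
  qed
qed

section \<open>Adding dummy control samples\<close>

text \<open>The dummies of treatment sample \<open>t\<close> share its levels and are free for \<open>t\<close>. Every other use of a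
  control sample costs at least \<open>w\<close>.\<close>

definition add_dummies :: "nat \<Rightarrow> nat \<Rightarrow> nat bm \<Rightarrow> nat bm" where
  "add_dummies k w I = I\<lparr>ctrl := ctrl I @ repeat_each k (treat I),
     dist := map (\<lambda>t. map (\<lambda>x. x + w) (dist I ! t) @
       repeat_each k (map (\<lambda>u. if u = t then 0 else w) [0..<num_treat I])) [0..<num_treat I]\<rparr>"

definition own_dummies :: "nat \<Rightarrow> nat bm \<Rightarrow> nat \<Rightarrow> nat set" where
  "own_dummies k I t = (+) (num_ctrl I) ` block k t"

lemma add_dummies_simps [simp]:
  "num_treat (add_dummies k w I) = num_treat I"
  "num_ctrl (add_dummies k w I) = num_ctrl I + num_treat I * k"
  "num_levels (add_dummies k w I) p = num_levels I p"
  "treat_part (add_dummies k w I) p i = treat_part I p i"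
  by (simp_all add: add_dummies_def num_treat_def num_ctrl_def num_levels_def treat_part_def)

lemma card_own_dummies [simp]: "card (own_dummies k I t) = k"
  and finite_own_dummies [simp]: "finite (own_dummies k I t)"
  by (simp_all add: own_dummies_def card_image)

lemma own_dummies_disjoint: "t \<noteq> u \<Longrightarrow> own_dummies k I t \<inter> own_dummies k I u = {}"
  using block_disjoint[of t u k] unfolding own_dummies_def by auto

lemma UN_own_dummies:
  "(\<Union>t<num_treat I. own_dummies k I t) = {num_ctrl I..<num_ctrl I + num_treat I * k}"
proof -
  have "(\<Union>t<num_treat I. own_dummies k I t) = (+) (num_ctrl I) ` {0..<num_treat I * k}"
    unfolding own_dummies_def UN_block[symmetric] atLeast0LessThan by blast
  then show ?thesis
    by (simp add: add.commute)
qed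

lemma own_dummies_subset:
  "t < num_treat I \<Longrightarrow> own_dummies k I t \<subseteq> {num_ctrl I..<num_ctrl I + num_treat I * k}"
  using UN_own_dummies[of k I] by blast

lemma own_dummies_ge: "c \<in> own_dummies k I t \<Longrightarrow> num_ctrl I \<le> c"
  by (auto simp: own_dummies_def)

text \<open>Dummies are appended behind the real controls, so an index comparison recognizes them.
  The second \<open>None\<close> is the case in which an assignment for the enlarged instance exists
  but does not yield one for \<open>I\<close>.\<close>

definition drop_dummies :: "'d bm \<Rightarrow> answer \<Rightarrow> answer" where
  "drop_dummies I ans = (case ans of None \<Rightarrow> None
    | Some xss \<Rightarrow> let yss = map (filter (\<lambda>c. c < num_ctrl I)) xss in
        if \<forall>ys\<in>set yss. length ys = 1 then Some yss else None)"

context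
  fixes k w :: nat and I :: "nat bm"
  assumes k: "0 < k" and wf: "well_formed I"
begin

lemma own_dummies_iff:
  "c \<in> own_dummies k I t \<longleftrightarrow> num_ctrl I \<le> c \<and> (c - num_ctrl I) div k = t"
  unfolding own_dummies_def using k by (auto simp: block_iff image_iff intro!: bexI[of _ "c - num_ctrl I"])

lemma delta_add_dummies:
  assumes "t < num_treat I" "c < num_ctrl I + num_treat I * k"
  shows "delta (add_dummies k w I) t c =
    (if c < num_ctrl I then delta I t c + w else if c \<in> own_dummies k I t then 0 else w)"
proof -
  from assms(1) wf have len: "length (dist I ! t) = num_ctrl I"
    by (simp add: well_formed_def num_treat_def num_ctrl_def)
  have "(c - num_ctrl I) div k < num_treat I" if "\<not> c < num_ctrl I"
    using assms(2) that k by (simp add: div_less_iff)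
  with assms len show ?thesis
    by (auto simp: delta_def add_dummies_def nth_append nth_repeat_each own_dummies_iff)
qed

lemma ctrl_part_add_dummies:
  "ctrl_part (add_dummies k w I) p i = ctrl_part I p i \<union> (\<Union>t\<in>treat_part I p i. own_dummies k I t)"
proof -
  have *: "ctrl (add_dummies k w I) ! c =
    (if c < num_ctrl I then ctrl I ! c else treat I ! ((c - num_ctrl I) div k))"
    if "c < num_ctrl I + num_treat I * k" for c
    using that by (auto simp: add_dummies_def num_ctrl_def num_treat_def nth_append nth_repeat_each)
  have "(c - num_ctrl I) div k < num_treat I \<longleftrightarrow> c < num_ctrl I + num_treat I * k"
    if "num_ctrl I \<le> c" for c
    using that k by (auto simp: div_less_iff)
  then show ?thesis
    by (auto simp: ctrl_part_def treat_part_def own_dummies_iff * split: if_splits)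
qed

lemma card_UN_own_dummies:
  "finite S \<Longrightarrow> card (\<Union>t\<in>S. own_dummies k I t) = card S * k"
  by (subst card_UN_disjoint) (simp_all add: own_dummies_disjoint)

lemma card_dummies_part:
  "card (\<Union>t\<in>treat_part I p i. own_dummies k I t) = k * card (treat_part I p i)"
  by (subst card_UN_own_dummies) (auto simp: treat_part_def)

lemma dummies_part_subset:
  "(\<Union>t\<in>treat_part I p i. own_dummies k I t) \<subseteq> {num_ctrl I..<num_ctrl I + num_treat I * k}"
  using own_dummies_subset unfolding treat_part_def by blast

text \<open>Each level gains \<open>k\<close> dummies per treatment sample on it, which is the
  difference between its demands for \<open>Suc k\<close> and for 1.\<close>

lemma feasible_add_own_dummies:
  assumes "feasible 1 I B"
  shows "feasible (Suc k) (add_dummies k w I) (\<lambda>t. B t \<union> own_dummies k I t)"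
proof (rule feasibleI, simp_all only: add_dummies_simps)
  note B = feasibleD[OF assms]
  have disj: "B t \<inter> own_dummies k I u = {}" if "t < num_treat I" for t u
    using B(1)[OF that] own_dummies_ge[of _ k I u] by fastforce
  fix t assume t: "t < num_treat I"
  show "B t \<union> own_dummies k I t \<subseteq> {..<num_ctrl I + num_treat I * k}"
    using B(1)[OF t] own_dummies_subset[OF t, of k] by auto
  show "card (B t \<union> own_dummies k I t) = Suc k"
    using B(2,3)[OF t] disj[OF t] by (subst card_Un_disjoint) auto
  fix u assume u: "u < num_treat I" "t \<noteq> u"
  then show "(B t \<union> own_dummies k I t) \<inter> (B u \<union> own_dummies k I u) = {}"
    using B(4)[OF t u] disj[OF t] disj[OF u(1)] own_dummies_disjoint[OF u(2), of k I] by blast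
next
  note B = feasibleD[OF assms]
  fix p i assume p: "p \<in> {1, 2 :: nat}" "i < num_levels I p"
  let ?D = "\<Union>t\<in>treat_part I p i. own_dummies k I t"
  have "(\<Union>t<num_treat I. B t \<union> own_dummies k I t) =
    (\<Union>t<num_treat I. B t) \<union> {num_ctrl I..<num_ctrl I + num_treat I * k}"
    unfolding UN_own_dummies[symmetric] by blast
  moreover have "(\<Union>t<num_treat I. B t) \<subseteq> {..<num_ctrl I}"
    using B(1) by blast
  moreover have "ctrl_part I p i \<subseteq> {..<num_ctrl I}"
    by (auto simp: ctrl_part_def)
  ultimately have "(\<Union>t<num_treat I. B t \<union> own_dummies k I t) \<inter> ctrl_part (add_dummies k w I) p i =
    ((\<Union>t<num_treat I. B t) \<inter> ctrl_part I p i) \<union> ?D"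
    unfolding ctrl_part_add_dummies using dummies_part_subset[of p i] by fastforce
  moreover have "((\<Union>t<num_treat I. B t) \<inter> ctrl_part I p i) \<inter> ?D = {}"
    using dummies_part_subset[of p i] by (auto simp: ctrl_part_def)
  moreover have "finite ((\<Union>t<num_treat I. B t) \<inter> ctrl_part I p i)" "finite ?D"
    by (auto simp: ctrl_part_def treat_part_def)
  ultimately have "card ((\<Union>t<num_treat I. B t \<union> own_dummies k I t) \<inter> ctrl_part (add_dummies k w I) p i) =
    card ((\<Union>t<num_treat I. B t) \<inter> ctrl_part I p i) + card ?D"
    by (simp add: card_Un_disjoint)
  then show "card ((\<Union>t<num_treat I. B t \<union> own_dummies k I t) \<inter> ctrl_part (add_dummies k w I) p i) =
    Suc k * card (treat_part I p i)"
    using B(5)[OF p] card_dummies_part[of p i] by simp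
qed

lemma cost_add_own_dummies:
  assumes "feasible 1 I B"
  shows "cost (add_dummies k w I) (\<lambda>t. B t \<union> own_dummies k I t) = num_treat I * w + cost I B"
proof -
  note B = feasibleD[OF assms]
  have "(\<Sum>c\<in>B t \<union> own_dummies k I t. delta (add_dummies k w I) t c) =
    w + (\<Sum>c\<in>B t. delta I t c)" if t: "t < num_treat I" for t
  proof -
    have disj: "B t \<inter> own_dummies k I t = {}"
      using B(1)[OF t] own_dummies_ge[of _ k I t] by fastforce
    have "(\<Sum>c\<in>own_dummies k I t. delta (add_dummies k w I) t c) = 0"
    proof (intro sum.neutral ballI)
      fix c assume "c \<in> own_dummies k I t"
      with own_dummies_subset[OF t, of k] t show "delta (add_dummies k w I) t c = 0"
        by (auto simp: delta_add_dummies subset_iff)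
    qed
    moreover have "(\<Sum>c\<in>B t. delta (add_dummies k w I) t c) = (\<Sum>c\<in>B t. delta I t c + w)"
      using B(1)[OF t] t by (intro sum.cong) (auto simp: delta_add_dummies subset_iff)
    ultimately show ?thesis
      using B(2,3)[OF t] disj by (simp add: sum.union_disjoint sum.distrib)
  qed
  then show ?thesis
    unfolding cost_def by (simp add: sum.distrib)
qed

context
  fixes A
  assumes A: "feasible (Suc k) (add_dummies k w I) A"
begin

lemmas feas = feasibleD[OF A, unfolded add_dummies_simps]

lemma delta_ge: "t < num_treat I \<Longrightarrow> c \<in> A t - own_dummies k I t \<Longrightarrow> w \<le> delta (add_dummies k w I) t c"
  using feas(1)[of t] by (auto simp: delta_add_dummies subset_iff)

lemma card_not_own: "t < num_treat I \<Longrightarrow> 1 \<le> card (A t - own_dummies k I t)"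
  using diff_card_le_card_Diff[of "own_dummies k I t" "A t"] feas(2)[of t] by simp

lemma single_real_if_cheap:
  assumes "cost (add_dummies k w I) A < Suc (num_treat I) * w" and t: "t < num_treat I"
  shows "card (A t \<inter> {..<num_ctrl I}) = 1"
proof -
  let ?r = "\<lambda>t. card (A t - own_dummies k I t)"
  have one: "?r t = 1" if t: "t < num_treat I" for t
  proof (rule ccontr)
    assume "?r t \<noteq> 1"
    with card_not_own[OF t] have "1 < ?r t"
      by linarith
    with t card_not_own have "(\<Sum>t<num_treat I. 1) < (\<Sum>t<num_treat I. ?r t)"
      by (intro sum_strict_mono_ex1) auto
    then have "Suc (num_treat I) * w \<le> (\<Sum>t<num_treat I. ?r t) * w"
      by (intro mult_right_mono) auto
    also have "\<dots> = (\<Sum>t<num_treat I. \<Sum>c\<in>A t - own_dummies k I t. w)"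
      by (simp add: sum_distrib_right)
    also have "\<dots> \<le> (\<Sum>t<num_treat I. \<Sum>c\<in>A t - own_dummies k I t. delta (add_dummies k w I) t c)"
      by (intro sum_mono delta_ge) auto
    also have "\<dots> \<le> cost (add_dummies k w I) A"
      unfolding cost_def add_dummies_simps using feas(3) by (intro sum_mono sum_mono2) auto
    finally show False
      using assms(1) by simp
  qed
  have own: "own_dummies k I t \<subseteq> A t" if t: "t < num_treat I" for t
  proof -
    have "card (A t \<inter> own_dummies k I t) = k"
      using card_Int_Diff[OF feas(3)[OF t], of "own_dummies k I t"] one[OF t] feas(2)[OF t] by simp
    then have "A t \<inter> own_dummies k I t = own_dummies k I t"
      by (intro card_subset_eq) auto
    then show ?thesis
      by blast
  qed
  \<comment> \<open>All dummies are held by their owners, so by disjointness the one further control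
    of \<open>t\<close> cannot be a dummy of another sample; it must be real.\<close>
  have "A t \<inter> {..<num_ctrl I} = A t - own_dummies k I t"
  proof (intro equalityI subsetI)
    fix c assume c: "c \<in> A t - own_dummies k I t"
    show "c \<in> A t \<inter> {..<num_ctrl I}"
    proof (rule ccontr)
      assume "c \<notin> A t \<inter> {..<num_ctrl I}"
      with c feas(1)[OF t] have "c \<in> (\<Union>u<num_treat I. own_dummies k I u)"
        unfolding UN_own_dummies by auto
      then obtain u where u: "u < num_treat I" "c \<in> own_dummies k I u"
        by blast
      with c own[OF u(1)] feas(4)[OF t u(1)] show False
        by (cases "t = u") auto
    qed
  qed (auto simp: own_dummies_ge dest: own_dummies_ge)
  with one[OF t] show ?thesis
    by simp
qed

context
  assumes single: "\<And>t. t < num_treat I \<Longrightarrow> card (A t \<inter> {..<num_ctrl I}) = 1"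
begin

text \<open>By counting, all dummies are in use, so that the real control samples balance alone.\<close>

lemma feasible_real: "feasible 1 I (\<lambda>t. A t \<inter> {..<num_ctrl I})"
proof (rule feasibleI)
  fix t u assume "t < num_treat I" "u < num_treat I" "t \<noteq> u"
  then show "A t \<inter> {..<num_ctrl I} \<inter> (A u \<inter> {..<num_ctrl I}) = {}"
    using feas(4)[of t u] by auto
next
  let ?m = "num_ctrl I" and ?n = "num_treat I"
  let ?U = "\<Union>t<?n. A t"
  have "card (A t - {..<?m}) = k" if t: "t < ?n" for t
    using card_Int_Diff[OF feas(3)[OF t], of "{..<?m}"] single[OF t] feas(2)[OF t] by simp
  then have "card (\<Union>t<?n. A t - {..<?m}) = ?n * k"
    using feas(3,4) by (subst card_UN_disjoint) (auto simp: disjoint_iff)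
  moreover have "(\<Union>t<?n. A t - {..<?m}) = ?U - {..<?m}"
    by blast
  moreover have "?U - {..<?m} \<subseteq> {?m..<?m + ?n * k}"
    using feas(1) by fastforce
  \<comment> \<open>Which sample holds which dummy is left open. Each holds \<open>k\<close> of
    them, \<open>?n * k\<close> in total, and there are no more.\<close>
  ultimately have all: "?U - {..<?m} = {?m..<?m + ?n * k}"
    by (intro card_subset_eq) auto
  fix p i assume p: "p \<in> {1, 2 :: nat}" "i < num_levels I p"
  let ?D = "\<Union>t\<in>treat_part I p i. own_dummies k I t"
  have "?D \<subseteq> ?U" "?D \<inter> {..<?m} = {}"
    using dummies_part_subset[of p i] unfolding all[symmetric] by (blast, blast)
  moreover have "ctrl_part I p i \<subseteq> {..<?m}"
    by (auto simp: ctrl_part_def)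
  moreover have "U \<inter> (C \<union> D) = (U \<inter> L \<inter> C) \<union> D \<and> U \<inter> L \<inter> C \<inter> D = {}"
    if "D \<subseteq> U" "D \<inter> L = {}" "C \<subseteq> L" for U C D L :: "nat set"
    using that by blast
  ultimately have "?U \<inter> ctrl_part (add_dummies k w I) p i = (?U \<inter> {..<?m} \<inter> ctrl_part I p i) \<union> ?D"
    "?U \<inter> {..<?m} \<inter> ctrl_part I p i \<inter> ?D = {}"
    unfolding ctrl_part_add_dummies by presburger+
  moreover have "finite (?U \<inter> {..<?m} \<inter> ctrl_part I p i)" "finite ?D"
    by (auto simp: treat_part_def)
  ultimately have "card (?U \<inter> ctrl_part (add_dummies k w I) p i) =
    card (?U \<inter> {..<?m} \<inter> ctrl_part I p i) + card ?D"
    by (simp add: card_Un_disjoint)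
  then have "card (?U \<inter> {..<?m} \<inter> ctrl_part I p i) = card (treat_part I p i)"
    using feas(5)[OF p] card_dummies_part[of p i] by simp
  moreover have "(\<Union>t<?n. A t \<inter> {..<?m}) = ?U \<inter> {..<?m}"
    by blast
  ultimately show "card ((\<Union>t<?n. A t \<inter> {..<?m}) \<inter> ctrl_part I p i) = 1 * card (treat_part I p i)"
    by simp
qed (use single in auto)

text \<open>Each sample holds one real control and so pays the surcharge \<open>w\<close> for it
  once. Dummies held by other samples than their owners can only raise the right-hand side.\<close>

lemma cost_real_le:
  "num_treat I * w + cost I (\<lambda>t. A t \<inter> {..<num_ctrl I}) \<le> cost (add_dummies k w I) A"
proof -
  have "num_treat I * w + cost I (\<lambda>t. A t \<inter> {..<num_ctrl I}) =
    (\<Sum>t<num_treat I. w + (\<Sum>c\<in>A t \<inter> {..<num_ctrl I}. delta I t c))"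
    by (simp add: cost_def sum.distrib)
  also have "\<dots> = (\<Sum>t<num_treat I. \<Sum>c\<in>A t \<inter> {..<num_ctrl I}. delta (add_dummies k w I) t c)"
    by (intro sum.cong refl) (simp add: delta_add_dummies sum.distrib single)
  also have "\<dots> \<le> cost (add_dummies k w I) A"
    unfolding cost_def add_dummies_simps using feas(3) by (intro sum_mono sum_mono2) auto
  finally show ?thesis .
qed

end
end

text \<open>If all samples keep one real control, then \<open>n * w\<close> plus the cost of the
  real part is at most the cost of the given assignment, hence at most
  \<open>n * w + cost I B\<close> for every feasible \<open>B\<close>, and \<open>n * w\<close>
  cancels. Otherwise a feasible \<open>B\<close> would make the optimum cheaper than
  \<open>Suc n * w\<close>, which forces single real controls, a contradiction.\<close>

lemma solution_drop_dummies:
  assumes w: "\<And>B. feasible 1 I B \<Longrightarrow> cost I B < w"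
    and sol: "solution (Suc k) (add_dummies k w I) ans"
  shows "solution 1 I (drop_dummies I ans)"
proof (cases ans)
  case None
  with sol have "\<not> feasible (Suc k) (add_dummies k w I) A" for A
    by (simp add: solution_def)
  then have "\<not> feasible 1 I B" for B
    using feasible_add_own_dummies by blast
  with None show ?thesis
    by (simp add: solution_def drop_dummies_def)
next
  case (Some xss)
  let ?A = "\<lambda>t. set (xss ! t)" and ?m = "num_ctrl I" and ?n = "num_treat I"
  from sol Some have len: "length xss = ?n" and dist: "\<forall>xs\<in>set xss. distinct xs"
    and opt: "optimal (Suc k) (add_dummies k w I) ?A"
    by (auto simp: solution_def)
  from opt have feas: "feasible (Suc k) (add_dummies k w I) ?A"
    by (simp add: optimal_def)
  have le: "cost (add_dummies k w I) ?A \<le> ?n * w + cost I B" if "feasible 1 I B" for B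
    using opt feasible_add_own_dummies[OF that] unfolding optimal_def
    by (simp flip: cost_add_own_dummies[OF that])
  define yss where "yss = map (filter (\<lambda>c. c < ?m)) xss"
  have yss: "set (yss ! t) = ?A t \<inter> {..<?m}" "card (?A t \<inter> {..<?m}) = length (yss ! t)"
    "yss ! t \<in> set yss" "distinct (yss ! t)" if "t < ?n" for t
  proof -
    show 1: "set (yss ! t) = ?A t \<inter> {..<?m}" "distinct (yss ! t)" "yss ! t \<in> set yss"
      using that len dist by (auto simp: yss_def)
    show "card (?A t \<inter> {..<?m}) = length (yss ! t)"
      using 1 by (simp flip: 1(1) add: distinct_card)
  qed
  show ?thesis
  proof (cases "\<forall>ys\<in>set yss. length ys = 1")
    case True
    then have single: "card (?A t \<inter> {..<?m}) = 1" if "t < ?n" for t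
      using yss[OF that] by simp
    have "optimal 1 I (\<lambda>t. ?A t \<inter> {..<?m})"
      unfolding optimal_def
    proof (intro conjI allI impI)
      show "feasible 1 I (\<lambda>t. ?A t \<inter> {..<?m})"
        by (rule feasible_real[OF feas single])
      show "cost I (\<lambda>t. ?A t \<inter> {..<?m}) \<le> cost I B" if "feasible 1 I B" for B
        using order_trans[OF cost_real_le[OF feas single] le[OF that]] by simp
    qed
    then have "optimal 1 I (\<lambda>t. set (yss ! t))"
      by (rule optimal_cong[THEN iffD1, rotated]) (simp add: yss)
    moreover have "\<forall>ys\<in>set yss. distinct ys"
      using dist by (auto simp: yss_def)
    moreover have "drop_dummies I ans = Some yss"
      unfolding drop_dummies_def Some option.case Let_def yss_def[symmetric] using True by simp
    moreover have "length yss = ?n"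
      by (simp add: yss_def len)
    ultimately show ?thesis
      by (simp add: solution_def)
  next
    case False
    then obtain t where t: "t < ?n" "length (yss ! t) \<noteq> 1"
      using len by (metis in_set_conv_nth length_map yss_def)
    have "\<not> feasible 1 I B" for B
    proof
      assume B: "feasible 1 I B"
      have "cost (add_dummies k w I) ?A < Suc ?n * w"
        using le[OF B] w[OF B] by simp
      from single_real_if_cheap[OF feas this t(1)] t yss(2)[OF t(1)] show False
        by simp
    qed
    moreover have "drop_dummies I ans = None"
      unfolding drop_dummies_def Some option.case Let_def yss_def[symmetric] using False by simp
    ultimately show ?thesis
      by (simp add: solution_def)
  qed
qed

end

section \<open>Computing the dummies\<close>

fun llen :: "data \<Rightarrow> nat" where
  "llen Leaf = 0"
| "llen (Node x L) = Suc (llen L)"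

lemma llen_eq_0_iff: "llen L = 0 \<longleftrightarrow> L = Leaf"
  by (cases L) auto

lemma llen_enc_list [simp]: "llen (enc_list f xs) = length xs"
  by (induction xs) auto

lemma llen_enc_unary [simp]: "llen (enc_unary n) = n"
  by (induction n) auto

lemma llen_dtl: "llen (dtl L) = llen L - 1"
  by (cases L) auto

lemma llen_ddrop: "llen (ddrop K L) = llen L - llen K"
proof (induction K arbitrary: L)
  case (Node x K)
  have "ddrop (Node x K) L = ddrop K (dtl L)"
    by (simp add: ddrop_def)
  with Node show ?case
    by (simp add: llen_dtl)
qed (simp add: ddrop_def)

lemma llen_dappend: "llen (dappend K L) = llen K + llen L"
  by (induction K) (auto simp: dappend_def)

lemma llen_le_dsize: "2 * llen L < dsize L"
proof (induction L)
  case (Node x L)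
  then show ?case using dsize_pos[of x] by simp
qed simp

lemma dfoldl_const: "dfoldl (\<lambda>_. g) a L = (g ^^ llen L) a"
  by (induction L arbitrary: a) (auto simp: funpow_swap1)

definition dconcat :: "data \<Rightarrow> data" where
  "dconcat L = dfoldr dappend Leaf L"

definition dlonger :: "data \<Rightarrow> data \<Rightarrow> data" where
  "dlonger x y = (if ddrop x y = Leaf then x else y)"

text \<open>Applied to the distances in binary it yields one with the most digits, so that a power
  of two above all of them is found without comparing numbers.\<close>

definition dlongest :: "data \<Rightarrow> data" where
  "dlongest L = dfoldr dlonger Leaf L"

lemma ptime_dconcat:
  assumes "ptime f"
  shows "ptime (\<lambda>d. dconcat (f d))"
  unfolding dconcat_def
proof (rule ptime_dfoldr_growth[where H = "\<lambda>_. dappend" and p = "[:0, 1:]"])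
  show "dsize (dappend x a) \<le> dsize a + poly [:0, 1:] (dsize d + dsize x)" for d x a
    using dsize_dappend_le[of x a] by simp
qed (intro ptime_intros assms)+

lemma ptime_dlongest:
  assumes "ptime f"
  shows "ptime (\<lambda>d. dlongest (f d))"
  unfolding dlongest_def
proof (rule ptime_dfoldr_growth[where H = "\<lambda>_. dlonger" and p = "[:0, 1:]"])
  show "dsize (dlonger x a) \<le> dsize a + poly [:0, 1:] (dsize d + dsize x)" for d x a
    by (simp add: dlonger_def)
  show "ptime (\<lambda>z. dlonger (dhd (dtl z)) (dtl (dtl z)))"
    unfolding dlonger_def by (intro ptime_intros)
qed (intro ptime_intros assms)+

lemma dconcat_enc_list: "dconcat (enc_list (enc_list f) xss) = enc_list f (concat xss)"
  unfolding dconcat_def by (induction xss) (auto simp: dappend_enc_list)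

lemma llen_dlonger: "llen (dlonger x y) = max (llen x) (llen y)"
  unfolding dlonger_def llen_eq_0_iff[symmetric] llen_ddrop by auto

lemma llen_dlongest_ge: "x \<in> set xs \<Longrightarrow> llen (f x) \<le> llen (dlongest (enc_list f xs))"
  unfolding dlongest_def by (induction xs) (auto simp: llen_dlonger)

text \<open>Since the longest entry is an actual distance, the bound on distances also limits the
  weight from above; \<open>Leaf\<close> is the default for an empty list.\<close>

lemma dlongest_in: "dlongest (enc_list f xs) \<in> insert Leaf (f ` set xs)"
  unfolding dlongest_def by (induction xs) (auto simp: dlonger_def)

section \<open>Halving and counting binary digits\<close>

definition dhalf :: "data \<Rightarrow> data" where
  "dhalf L = dhd (dfoldl (\<lambda>_ a. Node (dtl a) (Node Leaf (dhd a))) (Node Leaf Leaf) L)"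

text \<open>The pair of the lower and the upper half of \<open>n\<close> becomes that of
  \<open>Suc n\<close> when its components are swapped and the second one is incremented.\<close>

lemma dhalf_eq: "dhalf L = enc_unary (llen L div 2)"
proof -
  have "((\<lambda>a. Node (dtl a) (Node Leaf (dhd a))) ^^ n) (Node Leaf Leaf) =
    Node (enc_unary (n div 2)) (enc_unary (Suc n div 2))" for n
    by (induction n) auto
  then show ?thesis
    by (simp add: dhalf_def dfoldl_const)
qed

lemma ptime_dhalf:
  assumes "ptime f"
  shows "ptime (\<lambda>d. dhalf (f d))"
  unfolding dhalf_def
proof (intro ptime_dhd, rule ptime_dfoldl_growth[where p = "[:4:]" and
      H = "\<lambda>_ _ a. Node (dtl a) (Node Leaf (dhd a))"])
  show "dsize (Node (dtl a) (Node Leaf (dhd a))) \<le> dsize a + poly [:4:] (dsize d + dsize x)" for d x a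
    by (cases a) auto
qed (intro ptime_intros assms)+

text \<open>The state pairs the number still to be halved with the count of halvings, both in unary.
  It stays fixed once the number is 0, because the loop runs at least as often as there are
  digits.\<close>

definition log_step :: "data \<Rightarrow> data" where
  "log_step a = (if dhd a = Leaf then a else Node (dhalf (dhd a)) (Node Leaf (dtl a)))"

text \<open>A list whose length is the number of binary digits of the length of \<open>L\<close>.\<close>

definition dlog :: "data \<Rightarrow> data" where
  "dlog L = dtl (dfoldl (\<lambda>_. log_step) (Node L Leaf) L)"

lemma dsize_enc_unary: "dsize (enc_unary n) = Suc (2 * n)"
  by (induction n) auto

lemma ptime_dlog:
  assumes "ptime f"
  shows "ptime (\<lambda>d. dlog (f d))"
  unfolding dlog_def
proof (intro ptime_dtl, rule ptime_dfoldl_growth[where p = "[:4:]" and H = "\<lambda>_ _. log_step"])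
  show "dsize (log_step a) \<le> dsize a + poly [:4:] (dsize d + dsize x)" for d x a
    using llen_le_dsize[of "dhd a"] by (cases a) (auto simp: log_step_def dhalf_eq dsize_enc_unary)
  show "ptime (\<lambda>z. log_step (dtl (dtl z)))"
    unfolding log_step_def by (intro ptime_intros ptime_dhalf)
qed (intro ptime_intros assms)+

text \<open>A halving is counted only while the quotient of \<open>llen L\<close> by the current
  power is positive. The power is then at most \<open>llen L\<close>, and the next one at most twice
  that. The 1 covers the empty list.\<close>

lemma llen_dlog: "llen L < 2 ^ llen (dlog L)" "2 ^ llen (dlog L) \<le> 2 * llen L + 1"
proof -
  define s where "s = (\<lambda>j. (log_step ^^ j) (Node L Leaf))"
  have s_Suc: "s (Suc j) = log_step (s j)" for j
    by (simp add: s_def)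
  have inv: "llen (dhd (s j)) = llen L div 2 ^ llen (dtl (s j)) \<and>
    2 ^ llen (dtl (s j)) \<le> 2 * llen L + 1 \<and> (dhd (s j) = Leaf \<or> llen (dtl (s j)) = j)" for j
  proof (induction j)
    case 0
    show ?case
      by (simp add: s_def)
  next
    case (Suc j)
    show ?case
    proof (cases "dhd (s j) = Leaf")
      case True
      with Suc show ?thesis
        by (simp add: s_Suc log_step_def)
    next
      case False
      then have "0 < llen L div 2 ^ llen (dtl (s j))"
        using Suc llen_eq_0_iff[of "dhd (s j)"] by simp
      then have "2 ^ llen (dtl (s j)) \<le> llen L"
        by (meson div_greater_zero_iff)
      with False Suc show ?thesis
        by (simp add: s_Suc log_step_def dhalf_eq mult.commute flip: div_mult2_eq)
    qed
  qed
  have s: "dtl (s (llen L)) = dlog L"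
    by (simp add: s_def dlog_def dfoldl_const)
  have "dhd (s (llen L)) = Leaf \<or> llen (dlog L) = llen L"
    using inv[of "llen L"] s by auto
  \<comment> \<open>If the loop never reached 0, it counted \<open>llen L\<close> halvings, and
    \<open>llen L\<close> is below two to that power.\<close>
  then have "llen L div 2 ^ llen (dlog L) = 0"
    using inv[of "llen L"] s by auto
  then show "llen L < 2 ^ llen (dlog L)"
    by (simp add: div_eq_0_iff)
  show "2 ^ llen (dlog L) \<le> 2 * llen L + 1"
    using inv[of "llen L"] s by auto
qed

text \<open>Adding \<open>2 ^ llen K\<close> to a smaller number given in binary.\<close>

fun dpad :: "data \<Rightarrow> data \<Rightarrow> data" where
  "dpad Leaf d = Node (Node Leaf Leaf) Leaf"
| "dpad (Node x K) d = Node (dhd d) (dpad K (dtl d))"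

definition pad_step :: "data \<Rightarrow> data" where
  "pad_step a = Node (dtl (dhd a)) (Node (dhd (dhd a)) (dtl a))"

text \<open>The loop emits the digits in reverse; folding them onto the final digit one restores
  their order.\<close>

lemma dpad_eq:
  "dpad K d = dfoldl Node (Node (Node Leaf Leaf) Leaf) (dtl (dfoldl (\<lambda>_. pad_step) (Node d Leaf) K))"
proof -
  have "dfoldl Node (Node (Node Leaf Leaf) Leaf) (dtl (dfoldl (\<lambda>_. pad_step) (Node d e) K)) =
    dfoldl Node (dpad K d) e" for e
    by (induction K arbitrary: d e) (simp_all add: pad_step_def)
  from this[of Leaf] show ?thesis
    by simp
qed

lemma ptime_dpad:
  assumes "ptime f" "ptime g"
  shows "ptime (\<lambda>d. dpad (f d) (g d))"
  unfolding dpad_eq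
proof (rule ptime_dfoldl_growth[where H = "\<lambda>_. Node" and p = "[:1, 1:]"])
  show "ptime (\<lambda>d. dtl (dfoldl (\<lambda>_. pad_step) (Node (g d) Leaf) (f d)))"
  proof (intro ptime_dtl, rule ptime_dfoldl_growth[where H = "\<lambda>_ _. pad_step" and p = "[:4:]"])
    show "dsize (pad_step a) \<le> dsize a + poly [:4:] (dsize d + dsize x)" for d x a
    proof (cases a)
      case (Node b c)
      then show ?thesis by (cases b) (simp_all add: pad_step_def)
    qed (simp add: pad_step_def)
    show "ptime (\<lambda>z. pad_step (dtl (dtl z)))"
      unfolding pad_step_def by (intro ptime_intros)
  qed (intro ptime_intros assms)+
qed (auto intro!: ptime_intros)

section \<open>Binary numbers as trees\<close>

lemma enc_binary_0 [simp]: "enc_binary 0 = Leaf"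
  by (simp add: enc_binary.simps)

lemma dhd_enc_binary: "dhd (enc_binary n) = (if odd n then Node Leaf Leaf else Leaf)"
  by (subst enc_binary.simps) auto

lemma dtl_enc_binary: "dtl (enc_binary n) = enc_binary (n div 2)"
  by (subst enc_binary.simps) auto

text \<open>Reading past the last digit of \<open>n\<close> yields \<open>dhd Leaf = Leaf\<close>,
  which is the digit zero, so the padding needs no case distinction.\<close>

lemma dpad_enc_binary: "n < 2 ^ llen K \<Longrightarrow> dpad K (enc_binary n) = enc_binary (n + 2 ^ llen K)"
proof (induction K arbitrary: n)
  case Leaf
  then show ?case
    by (simp add: enc_binary.simps[of "Suc 0"])
next
  case (Node x K)
  then have "dpad K (enc_binary (n div 2)) = enc_binary (n div 2 + 2 ^ llen K)"
    by (intro Node.IH(2)) auto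
  moreover have "enc_binary (n + 2 ^ llen (Node x K)) =
      Node (if odd n then Node Leaf Leaf else Leaf) (enc_binary (n div 2 + 2 ^ llen K))"
    by (subst enc_binary.simps) (simp add: add.commute)
  ultimately show ?case
    by (simp add: dhd_enc_binary dtl_enc_binary)
qed

text \<open>A digit one takes more nodes than a digit zero, so the size of \<open>enc_binary\<close>
  is not monotone: 7 has a larger code than 8. Padding keeps all digits, so adding the weight does
  not shorten the encoding.\<close>

lemma dsize_dpad_ge: "llen d \<le> llen K \<Longrightarrow> dsize d \<le> dsize (dpad K d)"
proof (induction K arbitrary: d)
  case (Node x K)
  then show ?case
    by (cases d) (auto simp: dsize_pos Suc_leI)
qed (simp add: llen_eq_0_iff)

lemma llen_enc_binary: "n < 2 ^ llen (enc_binary n)" "2 ^ llen (enc_binary n) \<le> 2 * n + 1"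
proof (induction n rule: less_induct)
  case (less n)
  have "n < 2 ^ llen (enc_binary n) \<and> 2 ^ llen (enc_binary n) \<le> 2 * n + 1"
  proof (cases "n = 0")
    case False
    then have "llen (enc_binary n) = Suc (llen (enc_binary (n div 2)))"
      by (subst enc_binary.simps) simp
    moreover have "n div 2 < 2 ^ llen (enc_binary (n div 2))"
      "2 ^ llen (enc_binary (n div 2)) \<le> 2 * (n div 2) + 1"
      using less[of "n div 2"] False by simp_all
    moreover have "2 ^ llen (enc_binary (n div 2)) \<le> n"
    proof (cases "llen (enc_binary (n div 2))")
      case 0
      with False show ?thesis by simp
    next
      case (Suc l)
      \<comment> \<open>For even \<open>n\<close> the induction hypothesis alone allows the value
        \<open>n + 1\<close>; an even power cannot equal this odd number.\<close>
      then have "even ((2::nat) ^ llen (enc_binary (n div 2)))"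
        by simp
      with calculation(3) have "2 ^ llen (enc_binary (n div 2)) \<le> 2 * (n div 2)"
        by presburger
      then show ?thesis by linarith
    qed
    ultimately show ?thesis
      by simp
  qed simp
  then show "n < 2 ^ llen (enc_binary n)" "2 ^ llen (enc_binary n) \<le> 2 * n + 1"
    by auto
qed

lemma llen_enc_binary_le: "n < 2 ^ l \<Longrightarrow> llen (enc_binary n) \<le> l"
proof (induction l arbitrary: n)
  case (Suc l)
  show ?case
  proof (cases "n = 0")
    case False
    then have "llen (enc_binary n) = Suc (llen (enc_binary (n div 2)))"
      by (subst enc_binary.simps) simp
    with Suc.IH[of "n div 2"] Suc.prems show ?thesis
      by auto
  qed simp
qed simp

text \<open>Tags the entries of a list with distinct numbers, counting down to 1 at the last entry.\<close>

definition tag_step :: "data \<Rightarrow> data \<Rightarrow> data" where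
  "tag_step x a = Node (Node (Node Leaf (dhd (dhd a))) x) a"

definition dtag :: "data \<Rightarrow> data" where
  "dtag L = dfoldr tag_step Leaf L"

lemma dtag_Node: "dtag (Node x L) = Node (Node (enc_unary (Suc (llen L))) x) (dtag L)"
proof -
  have "dhd (dhd (dtag L)) = enc_unary (llen L)" for L
    by (induction L) (auto simp: dtag_def tag_step_def)
  then show ?thesis
    by (simp add: dtag_def tag_step_def)
qed

lemma dtag_Leaf: "dtag Leaf = Leaf"
  by (simp add: dtag_def)

lemma dsize_dtag_le: "dsize (dtag L) \<le> dsize L + llen L * (2 * llen L + 5)"
  by (induction L) (auto simp: dtag_Leaf dtag_Node dsize_enc_unary algebra_simps)

text \<open>The step copies the last tag out of the accumulator, so its growth depends on the
  accumulator. The quadratic size bound is therefore proved directly.\<close>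

lemma ptime_dtag:
  assumes "ptime f"
  shows "ptime (\<lambda>d. dtag (f d))"
  unfolding dtag_def
proof (rule ptime_dfoldr[where H = "\<lambda>_. tag_step" and p = "[:0, 6, 2:]"])
  fix d L
  have "dsize (dtag L) \<le> dsize L + llen L * (2 * llen L + 5)"
    by (rule dsize_dtag_le)
  also have "\<dots> \<le> (dsize d + dsize L) + (dsize d + dsize L) * (2 * (dsize d + dsize L) + 5)"
    using llen_le_dsize[of L] by (intro add_mono mult_mono) auto
  also have "\<dots> = poly [:0, 6, 2:] (dsize d + dsize L)"
    by (simp add: algebra_simps)
  finally show "dsize (dfoldr tag_step Leaf L) \<le> poly [:0, 6, 2:] (dsize d + dsize L)"
    by (simp add: dtag_def)
  show "ptime (\<lambda>z. tag_step (dhd (dtl z)) (dtl (dtl z)))"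
    unfolding tag_step_def by (intro ptime_intros)
qed (intro ptime_intros assms)+

lemma dtag_enc_list:
  "dtag (enc_list f xs) =
    enc_list (\<lambda>t. Node (enc_unary (length xs - t)) (f (xs ! t))) [0..<length xs]"
proof (induction xs)
  case (Cons x xs)
  have "enc_list (\<lambda>t. Node (enc_unary (length (x # xs) - t)) (f ((x # xs) ! t))) [0..<length (x # xs)] =
    Node (Node (enc_unary (Suc (length xs))) (f x))
      (enc_list (\<lambda>t. Node (enc_unary (length xs - t)) (f (xs ! t))) [0..<length xs])"
    by (simp add: upt_conv_Cons enc_list_def map_Suc_upt[symmetric] foldr_map comp_def del: upt_Suc)
  with Cons show ?case
    by (simp add: dtag_Node)
qed (simp add: dtag_Leaf)

text \<open>Its length is the exponent of the weight. Appending adds lengths and so multiplies two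
  powers: one above the number of treatment samples, the other above every distance.\<close>

definition weight_bits :: "data \<Rightarrow> data \<Rightarrow> data" where
  "weight_bits tr di = dappend (dlog tr) (dlongest (dconcat di))"

text \<open>\<open>T\<close> lists all rows with their tags and also supplies the columns of the
  dummies: equal tags mean that a dummy belongs to the row \<open>r\<close>. \<open>Leaf\<close> is
  the distance 0 and \<open>dpad K Leaf\<close> the weight itself.\<close>

definition dummy_row :: "nat \<Rightarrow> data \<Rightarrow> data \<Rightarrow> data \<Rightarrow> data" where
  "dummy_row k K T r = dappend (dmap (dpad K) (dtl r))
     (drepeat k (dmap (\<lambda>r'. if dhd r' = dhd r then Leaf else dpad K Leaf) T))"

definition dummy_dist :: "nat \<Rightarrow> data \<Rightarrow> data \<Rightarrow> data" where
  "dummy_dist k K T = dmap (dummy_row k K T) T"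

definition dummies_pre :: "nat \<Rightarrow> data \<Rightarrow> data" where
  "dummies_pre k d = Node (dhd d) (Node (dhd (dtl d)) (Node (dhd (dtl (dtl d)))
     (Node (dappend (dhd (dtl (dtl (dtl d)))) (drepeat k (dhd (dtl (dtl d)))))
       (dummy_dist k (weight_bits (dhd (dtl (dtl d))) (dtl (dtl (dtl (dtl d)))))
         (dtag (dtl (dtl (dtl (dtl d)))))))))"

lemma ptime_dummies_pre: "ptime (dummies_pre k)"
proof -
  have row: "ptime (\<lambda>d. dummy_row k (f d) (g d) (h d))" if "ptime f" "ptime g" "ptime h" for f g h
  proof -
    have "ptime (\<lambda>d. f (dhd d))" "ptime (\<lambda>d. h (dhd d))"
      by (rule ptime_comp[OF ptime_dhd[OF ptime_id] that(1)]
          ptime_comp[OF ptime_dhd[OF ptime_id] that(3)])+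
    then show ?thesis
      unfolding dummy_row_def
      by (intro ptime_intros ptime_dpad that)
  qed
  have "ptime (\<lambda>d. dummy_dist k (f d) (g d))" if "ptime f" "ptime g" for f g
  proof -
    have "ptime (\<lambda>d. f (dhd d))" "ptime (\<lambda>d. g (dhd d))"
      by (rule ptime_comp[OF ptime_dhd[OF ptime_id] that(1)]
          ptime_comp[OF ptime_dhd[OF ptime_id] that(2)])+
    then show ?thesis
      unfolding dummy_dist_def
      by (intro ptime_dmap row that ptime_dtl ptime_id)
  qed
  note dist = this
  show ?thesis
    unfolding dummies_pre_def weight_bits_def
    by (intro ptime_intros dist ptime_dlog ptime_dlongest ptime_dconcat ptime_dtag)
qed

text \<open>An index \<open>c\<close> in unary is itself a list; it belongs to a real control iff
  dropping that many entries from the list \<open>ct\<close> of real controls leaves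
  something.\<close>

definition real_controls :: "data \<Rightarrow> data \<Rightarrow> data" where
  "real_controls ct = dfoldr (\<lambda>c a. if ddrop c ct = Leaf then a else Node c a) Leaf"

definition all_singletons :: "data \<Rightarrow> data" where
  "all_singletons = dfoldr (\<lambda>y a. if y = Leaf then Leaf else if dtl y = Leaf then a else Leaf) (Node Leaf Leaf)"

definition dummies_post :: "data \<Rightarrow> data" where
  "dummies_post z = (if dtl z = Leaf then Leaf
     else if all_singletons (dmap (real_controls (dhd (dtl (dtl (dtl (dhd z)))))) (dhd (dtl z))) = Leaf
     then Leaf else Node (dmap (real_controls (dhd (dtl (dtl (dtl (dhd z)))))) (dhd (dtl z))) Leaf)"

lemma ptime_dummies_post: "ptime dummies_post"
proof -
  have real: "ptime (\<lambda>d. real_controls (f d) (g d))" if "ptime f" "ptime g" for f g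
    unfolding real_controls_def
  proof (rule ptime_dfoldr_growth[where p = "[:1, 1:]" and
        H = "\<lambda>d c a. if ddrop c (f d) = Leaf then a else Node c a"])
    have "ptime (\<lambda>d. f (dhd d))"
      by (rule ptime_comp[OF ptime_dhd[OF ptime_id] that(1)])
    then show "ptime (\<lambda>z. if ddrop (dhd (dtl z)) (f (dhd z)) = Leaf then dtl (dtl z)
      else Node (dhd (dtl z)) (dtl (dtl z)))"
      by (intro ptime_intros)
  qed (auto intro: ptime_intros that)
  have single: "ptime (\<lambda>d. all_singletons (f d))" if "ptime f" for f
    unfolding all_singletons_def
  proof (rule ptime_dfoldr_growth[where p = "[:1:]" and
        H = "\<lambda>d y a. if y = Leaf then Leaf else if dtl y = Leaf then a else Leaf"])
    show "ptime (\<lambda>z. if dhd (dtl z) = Leaf then Leaf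
      else if dtl (dhd (dtl z)) = Leaf then dtl (dtl z) else Leaf)"
      by (intro ptime_intros)
  qed (auto intro: ptime_intros that)
  show ?thesis
    unfolding dummies_post_def by (intro ptime_intros real single)
qed

section \<open>The weight, and correctness of the computed encodings\<close>

definition dummy_weight :: "nat bm \<Rightarrow> nat" where
  "dummy_weight I = 2 ^ llen (weight_bits (enc_list enc_pair (treat I)) (enc_list (enc_list enc_binary) (dist I)))"

lemma dummy_weight_eq: "dummy_weight I = 2 ^ llen (dlog (enc_list enc_pair (treat I))) *
    2 ^ llen (dlongest (enc_list enc_binary (concat (dist I))))"
  by (simp add: dummy_weight_def weight_bits_def llen_dappend power_add dconcat_enc_list)

lemma distance_less:
  assumes "x \<in> set (concat (dist I))"
  shows "x < 2 ^ llen (dlongest (enc_list enc_binary (concat (dist I))))"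
  by (rule less_le_trans[OF llen_enc_binary(1) power_increasing])
     (use llen_dlongest_ge[OF assms] in auto)

lemma distance_less_dummy_weight:
  assumes "x \<in> set (concat (dist I))"
  shows "x < dummy_weight I"
proof -
  have "1 * 2 ^ llen (dlongest (enc_list enc_binary (concat (dist I)))) \<le> dummy_weight I"
    unfolding dummy_weight_eq by (intro mult_right_mono) auto
  with distance_less[OF assms] show ?thesis
    by simp
qed

lemma delta_in_dist:
  assumes "well_formed I" "t < num_treat I" "c < num_ctrl I"
  shows "delta I t c \<in> set (concat (dist I))"
  using assms unfolding well_formed_def num_treat_def num_ctrl_def delta_def set_concat UN_iff
  by (intro bexI[of _ "dist I ! t"]) auto

text \<open>With one control per sample the cost is at most the number of samples times
  \<open>?M\<close>. Strictness comes from the other factor of the weight, which exceeds the number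
  of samples even if that is 0.\<close>

lemma cost_less_dummy_weight:
  assumes wf: "well_formed I" and B: "feasible 1 I B"
  shows "cost I B < dummy_weight I"
proof -
  let ?M = "2 ^ llen (dlongest (enc_list enc_binary (concat (dist I)))) :: nat"
  have "(\<Sum>c\<in>B t. delta I t c) \<le> ?M" if t: "t < num_treat I" for t
  proof -
    from feasibleD(2)[OF B t] obtain c where c: "B t = {c}"
      by (auto simp: card_1_singleton_iff)
    with feasibleD(1)[OF B t] distance_less[OF delta_in_dist[OF wf t, of c]] show ?thesis
      by simp
  qed
  then have "cost I B \<le> num_treat I * ?M"
    using sum_bounded_above[of "{..<num_treat I}" "\<lambda>t. \<Sum>c\<in>B t. delta I t c" ?M]
    by (simp add: cost_def)
  also have "\<dots> < dummy_weight I"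
    unfolding dummy_weight_eq using llen_dlog(1)[of "enc_list enc_pair (treat I)"]
    by (simp add: num_treat_def)
  finally show ?thesis .
qed

lemma enc_list_map: "enc_list f (map g xs) = enc_list (\<lambda>x. f (g x)) xs"
  by (induction xs) auto

lemma enc_list_cong: "(\<And>x. x \<in> set xs \<Longrightarrow> f x = g x) \<Longrightarrow> enc_list f xs = enc_list g xs"
  by (induction xs) auto

lemma dummies_pre_enc:
  assumes "well_formed I"
  shows "dummies_pre k (enc_bm I) = enc_bm (add_dummies k (dummy_weight I) I)"
proof -
  let ?n = "num_treat I" and ?w = "dummy_weight I"
  define K where "K = weight_bits (enc_list enc_pair (treat I)) (enc_list (enc_list enc_binary) (dist I))"
  have w: "?w = 2 ^ llen K"
    by (simp add: K_def dummy_weight_def)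
  have n: "length (dist I) = ?n"
    using assms by (simp add: well_formed_def num_treat_def)
  define T where "T = enc_list (\<lambda>t. Node (enc_unary (?n - t)) (enc_list enc_binary (dist I ! t))) [0..<?n]"
  have T: "dtag (enc_list (enc_list enc_binary) (dist I)) = T"
    by (simp add: dtag_enc_list n T_def)
  have W: "dpad K Leaf = enc_binary ?w"
    using dpad_enc_binary[of 0 K] by (simp add: w)
  have "dummy_row k K T (Node (enc_unary (?n - t)) (enc_list enc_binary (dist I ! t))) =
    enc_list enc_binary (map (\<lambda>x. x + ?w) (dist I ! t) @
      repeat_each k (map (\<lambda>u. if u = t then 0 else ?w) [0..<?n]))" if t: "t < ?n" for t
  proof -
    have "dpad K (enc_binary x) = enc_binary (x + ?w)" if "x \<in> set (dist I ! t)" for x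
    proof -
      have "x \<in> set (concat (dist I))"
        using that t n by auto
      then show ?thesis
        using distance_less_dummy_weight[of x I] by (simp add: w dpad_enc_binary)
    qed
    then have "dmap (dpad K) (enc_list enc_binary (dist I ! t)) =
      enc_list enc_binary (map (\<lambda>x. x + ?w) (dist I ! t))"
      by (auto simp: dmap_enc_list enc_list_map intro: enc_list_cong)
    \<comment> \<open>Truncated subtraction is harmless: \<open>?n - t\<close> is injective for
      \<open>t < ?n\<close>, so tags agree only on the diagonal.\<close>
    moreover have "dmap (\<lambda>r. if dhd r = enc_unary (?n - t) then Leaf else dpad K Leaf) T =
      enc_list enc_binary (map (\<lambda>u. if u = t then 0 else ?w) [0..<?n])"
      unfolding T_def dmap_enc_list enc_list_map W
      using t by (intro enc_list_cong) (auto simp: inj_eq[OF enc_unary_inj])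
    ultimately show ?thesis
      by (simp add: dummy_row_def drepeat_enc_list dappend_enc_list repeat_each_def)
  qed
  then have "dummy_dist k K T = enc_list (enc_list enc_binary) (dist (add_dummies k ?w I))"
    unfolding dummy_dist_def
    by (subst (2) T_def) (auto simp: dmap_enc_list add_dummies_def enc_list_map intro: enc_list_cong)
  then show ?thesis
    by (simp add: dummies_pre_def enc_bm_def T add_dummies_def drepeat_enc_list dappend_enc_list
        repeat_each_def flip: K_def)
qed

lemma real_controls_enc:
  "real_controls (enc_list f cs) (enc_list enc_unary xs) =
    enc_list enc_unary (filter (\<lambda>c. c < length cs) xs)"
  unfolding real_controls_def
  by (induction xs) (auto simp: ddrop_enc_unary enc_list_eq_Leaf_iff)

lemma all_singletons_enc:
  "all_singletons (enc_list (enc_list f) xss) = Leaf \<longleftrightarrow> \<not> (\<forall>xs\<in>set xss. length xs = 1)"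
  unfolding all_singletons_def
proof (induction xss)
  case (Cons xs xss)
  have "length xs = 1 \<longleftrightarrow> xs \<noteq> [] \<and> tl xs = []"
    by (cases xs) auto
  with Cons show ?case
    by (simp add: enc_list_eq_Leaf_iff dtl_enc_list)
qed simp

lemma dummies_post_enc:
  "dummies_post (Node (enc_bm I) (enc_answer ans)) = enc_answer (drop_dummies I ans)"
  by (cases ans)
     (simp_all add: dummies_post_def enc_bm_def enc_answer_def drop_dummies_def dmap_enc_list
       real_controls_enc num_ctrl_def all_singletons_enc Let_def
       flip: enc_list_map[of "enc_list enc_unary" "filter (\<lambda>c. c < length (ctrl I))"])

lemma dsize_enc_list: "dsize (enc_list f xs) = Suc (\<Sum>x\<leftarrow>xs. Suc (dsize (f x)))"
  by (induction xs) auto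

lemma dsize_enc_list_append_ge: "dsize (enc_list f xs) \<le> dsize (enc_list f (xs @ ys))"
  by (simp add: dsize_enc_list)

text \<open>The polynomial bound on distances is evaluated at the length of the new instance, which
  must therefore not fall below the old one.\<close>

lemma dsize_add_dummies_ge:
  assumes "well_formed I"
  shows "dsize (enc_bm I) \<le> dsize (enc_bm (add_dummies k (dummy_weight I) I))"
proof -
  let ?n = "num_treat I" and ?w = "dummy_weight I"
  have n: "length (dist I) = ?n"
    using assms by (simp add: well_formed_def num_treat_def)
  have "dsize (enc_binary x) \<le> dsize (enc_binary (x + ?w))" if "x \<in> set (concat (dist I))" for x
  proof -
    have "dsize (enc_binary x) \<le> dsize (dpad (weight_bits (enc_list enc_pair (treat I))
      (enc_list (enc_list enc_binary) (dist I))) (enc_binary x))"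
      using distance_less_dummy_weight[OF that]
      by (intro dsize_dpad_ge llen_enc_binary_le) (simp add: dummy_weight_def)
    then show ?thesis
      using distance_less_dummy_weight[OF that] by (simp add: dummy_weight_def dpad_enc_binary)
  qed
  moreover have "x \<in> set (concat (dist I))" if "t < ?n" "x \<in> set (dist I ! t)" for t x
    using that n by auto
  ultimately have "dsize (enc_list enc_binary (dist I ! t)) \<le>
    dsize (enc_list enc_binary (map (\<lambda>x. x + ?w) (dist I ! t)))" if "t < ?n" for t
    unfolding dsize_enc_list map_map comp_def using that
    by (simp del: set_concat add: sum_list_mono)
  then have "dsize (enc_list (enc_list enc_binary) (map (\<lambda>t. dist I ! t) [0..<?n])) \<le>
    dsize (enc_list (enc_list enc_binary) (dist (add_dummies k ?w I)))"
    unfolding dsize_enc_list[of "enc_list enc_binary"] add_dummies_def map_map comp_def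
    by (auto intro!: sum_list_mono order_trans[OF _ dsize_enc_list_append_ge])
  also have "map (\<lambda>t. dist I ! t) [0..<?n] = dist I"
    using map_nth[of "dist I"] n by simp
  finally have "dsize (enc_list (enc_list enc_binary) (dist I)) \<le>
    dsize (enc_list (enc_list enc_binary) (dist (add_dummies k ?w I)))" .
  then show ?thesis
    by (auto simp: enc_bm_def add_dummies_def intro!: add_mono dsize_enc_list_append_ge)
qed

text \<open>A power of two with as many digits as \<open>x\<close> is at most
  \<open>2 * x + 1\<close>. With \<open>s\<close> the old encoding length, the factors of the weight
  are thus at most \<open>2 * s + 1\<close>, from the number of samples, and twice \<pi> at
  \<open>s\<close> plus 1, from the longest distance. The first summand \<pi> pays for the original
  distance.\<close>

lemma BM'_instances_add_dummies:
  assumes k: "0 < k" and I: "I \<in> BM'_instances K \<pi>"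
  shows "add_dummies k (dummy_weight I) I \<in> BM'_instances K (\<pi> + (2 * \<pi> + 1) * [:1, 2:])"
proof -
  let ?w = "dummy_weight I" and ?s = "dsize (enc_bm I)" and ?\<pi> = "\<pi> + (2 * \<pi> + 1) * [:1, 2:]"
  let ?J = "add_dummies k ?w I"
  from I have wf: "well_formed I" and K: "num_levels I 2 = K"
    and \<pi>: "\<And>t c. t < num_treat I \<Longrightarrow> c < num_ctrl I \<Longrightarrow> delta I t c \<le> poly \<pi> ?s"
    by (auto simp: BM'_instances_def)
  have n: "length (dist I) = num_treat I"
    using wf by (simp add: well_formed_def num_treat_def)
  have "num_treat I \<le> ?s"
    using llen_le_dsize[of "enc_list enc_pair (treat I)"] by (simp add: enc_bm_def num_treat_def)
  then have log: "2 ^ llen (dlog (enc_list enc_pair (treat I))) \<le> 2 * ?s + 1"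
    using llen_dlog(2)[of "enc_list enc_pair (treat I)"] by (simp add: num_treat_def)
  have dist: "x \<le> poly \<pi> ?s" if x: "x \<in> set (concat (dist I))" for x
  proof -
    from x obtain t c where "t < length (dist I)" "c < length (dist I ! t)" "x = delta I t c"
      by (auto simp: in_set_conv_nth delta_def)
    with wf \<pi>[of t c] n show ?thesis
      by (simp add: well_formed_def num_ctrl_def)
  qed
  have "2 ^ llen (dlongest (enc_list enc_binary (concat (dist I)))) \<le> 2 * poly \<pi> ?s + 1"
  proof (cases "dlongest (enc_list enc_binary (concat (dist I))) = Leaf")
    case False
    with dlongest_in[of enc_binary "concat (dist I)"] obtain x where
      x: "x \<in> set (concat (dist I))" "dlongest (enc_list enc_binary (concat (dist I))) = enc_binary x"
      by auto
    with llen_enc_binary(2)[of x] dist[OF x(1)] show ?thesis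
      by simp
  qed simp
  then have "?w \<le> (2 * ?s + 1) * (2 * poly \<pi> ?s + 1)"
    unfolding dummy_weight_eq by (intro mult_mono log) auto
  then have w: "poly \<pi> ?s + ?w \<le> poly ?\<pi> ?s"
    by (simp add: algebra_simps)
  have "well_formed ?J"
    using wf k by (auto simp: well_formed_def add_dummies_def num_treat_def set_repeat_each)
  moreover have "delta ?J t c \<le> poly ?\<pi> (dsize (enc_bm ?J))"
    if "t < num_treat I" "c < num_ctrl I + num_treat I * k" for t c
  proof -
    have "delta ?J t c \<le> poly \<pi> ?s + ?w"
      using \<pi>[of t c] that by (simp add: delta_add_dummies[OF k wf])
    also note w
    also have "poly ?\<pi> ?s \<le> poly ?\<pi> (dsize (enc_bm ?J))"
      by (intro poly_nat_mono dsize_add_dummies_ge wf)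
    finally show ?thesis .
  qed
  ultimately show ?thesis
    using K by (simp add: BM'_instances_def)
qed

lemma BM'_if_kappa_BM':
  assumes k: "0 < k" and "kappa_BM'_poly_time (Suc k) K (\<pi> + (2 * \<pi> + 1) * [:1, 2:])"
  shows "BM'_poly_time K \<pi>"
  unfolding BM'_poly_time_def kappa_BM'_poly_time_def
proof (rule poly_time_solvable_reduction)
  show "poly_time_solvable (BM'_instances K (\<pi> + (2 * \<pi> + 1) * [:1, 2:])) enc_bm
    (\<lambda>I d. \<exists>ans. d = enc_answer ans \<and> solution (Suc k) I ans)"
    using assms(2) by (simp add: kappa_BM'_poly_time_def)
  fix I assume I: "I \<in> BM'_instances K \<pi>"
  then have wf: "well_formed I"
    by (simp add: BM'_instances_def)
  let ?J = "add_dummies k (dummy_weight I) I"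
  have "\<exists>ans'. dummies_post (Node (enc_bm I) (enc_answer ans)) = enc_answer ans' \<and> solution 1 I ans'"
    if "solution (Suc k) ?J ans" for ans
    using solution_drop_dummies[OF k wf cost_less_dummy_weight[OF wf] that] dummies_post_enc
    by blast
  then show "\<exists>J\<in>BM'_instances K (\<pi> + (2 * \<pi> + 1) * [:1, 2:]). dummies_pre k (enc_bm I) = enc_bm J \<and>
    (\<forall>d. (\<exists>ans. d = enc_answer ans \<and> solution (Suc k) J ans) \<longrightarrow>
      (\<exists>ans. dummies_post (Node (enc_bm I) d) = enc_answer ans \<and> solution 1 I ans))"
    using dummies_pre_enc[OF wf] by (intro bexI[OF _ BM'_instances_add_dummies[OF k I]]) auto
qed (rule ptime_dummies_pre ptime_dummies_post)+

theorem theorem4p6: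
  fixes \<kappa> K :: nat
  assumes "\<kappa> \<ge> 2"
  shows "(\<forall>\<pi> :: nat poly. BM'_poly_time K \<pi>) \<longleftrightarrow>
         (\<forall>\<pi> :: nat poly. kappa_BM'_poly_time \<kappa> K \<pi>)"
proof
  assume "\<forall>\<pi>. BM'_poly_time K \<pi>"
  with assms show "\<forall>\<pi>. kappa_BM'_poly_time \<kappa> K \<pi>"
    by (intro allI kappa_BM'_if_BM') auto
next
  assume *: "\<forall>\<pi>. kappa_BM'_poly_time \<kappa> K \<pi>"
  show "\<forall>\<pi>. BM'_poly_time K \<pi>"
  proof
    fix \<pi>
    \<comment> \<open>Besides the real control, \<open>\<kappa> - 1\<close> dummies per sample are
      to be consumed.\<close>
    from assms have "0 < \<kappa> - 1" "Suc (\<kappa> - 1) = \<kappa>"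
      by simp_all
    with * show "BM'_poly_time K \<pi>"
      by (intro BM'_if_kappa_BM'[of "\<kappa> - 1"]) metis+
  qed
qed

end
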